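(* For every computable perfect Polish space $X$, $$\mathsf{BCT}_{0,X}'\equiv_{\mathrm{sW}}\mathsf{BCT}_{2,X}\quad\text{and}\quad \mathsf{BCT}_{1,X}'\equiv_{\mathrm{sW}}\mathsf{BCT}_{3,X}\equiv_{\mathrm{sW}}\mathsf{CL}_{\mathbb N}.$$
   Context: Represented spaces and Weihrauch reducibility. The symbol $\subseteq$ in front of a domain means "possibly partial". A represented space $(X,\delta_X)$ is a set $X$ with a surjective partial map $\delta_X:\subseteq\mathbb N^{\mathbb N}\to X$. A multi-valued function $f:\subseteq X\rightrightarrows Y$ assigns to each $x\in\mathrm{dom}(f)$ a nonempty set $f(x)\subseteq Y$ of possible values. A realizer $F\vdash f$ is a partial function $F:\subseteq\mathbb N^{\mathbb N}\to\mathbb N^{\mathbb N}$ with $\delta_YF(p)\in f(\delta_X(p))$ for all $p\in\mathrm{dom}(f\delta_X)$. Strong Weihrauch reducibility $f\le_{\mathrm{sW}}g$: there are computable $K,H:\subseteq\mathbb N^{\mathbb N}\to\mathbb N^{\mathbb N}$ with $HGK\vdash f$ for all $G\vdash g$. $f\equiv_{\mathrm{sW}}g$ means $f\le_{\mathrm{sW}}g$ and $g\le_{\mathrm{sW}}f$. With $\langle p_0,p_1,\dots\rangle(\langle i,j\rangle):=p_i(j)$, the sequence space $X^{\mathbb N}$ is represented by $\delta_X^{\mathbb N}\langle p_0,p_1,\dots\rangle:=(\delta_X(p_i))_i$. $\mathbb N$ carries its canonical representation ($p$ names $p(0)$). Jump. $\lim:\subseteq\mathbb N^{\mathbb N}\to\mathbb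 N^{\mathbb N}$, $\langle p_0,p_1,\dots\rangle\mapsto\lim_n p_n$ (product topology). The jump $f'$ of $f:\subseteq(X,\delta_X)\rightrightarrows(Y,\delta_Y)$ is the same multi-valued function with input representation replaced by $\delta_X\circ\lim$. Computable metric spaces. A computable metric space $(X,d,\alpha)$ is a metric space $(X,d)$ with a dense sequence $\alpha:\mathbb N\to X$ such that $d\circ(\alpha\times\alpha):\mathbb N^2\to\mathbb R$ is computable; it is a computable Polish space if it is also complete; it is perfect if it has no isolated points. Its Cauchy representation is $\delta_X(p)=\lim_n\alpha(p(n))$, for those $p$ such that the limit exists and $d(\alpha p(n),\alpha p(k))<2^{-k}$ for all $k$ and $n\ge k$. $X\sqcup\{\infty\}$ is $X$ with an additional isolated point $\infty$ at distance $1$ from all other points. Hyperspaces. $\mathcal A_-(X)$ is the set of closed subsets of $X$ with representation $\psi_-(p):=X\setminus\bigcup_iB_{p(i)}$, where $B_{\langle n,k\rangle}:=B(\alpha(n),\overline k)$ and $\overline k$ is the $k$-th rational in a standard enumeration. $\mathcal A_+(X)$ is the set of closed subsets of $X$ with representation $\psi_+(p)=A$ iff $\delta^{\mathbb N}_{X\sqcup\{\infty\}}(p)=(x_n)_n$ and $\overline{\{x_n:n\in\mathbb N\}}\cap X=A$. Baire category problems. $\mathsf{BCT}_{0,X}:\subseteq\mathcal A_-(X)^{\mathbb N}\rightrightarrows X$ and $\mathsf{BCT}_{2,X}:\subseteq\mathcal A_+(X)^{\mathbb N}\rightrightarrows X$ both map $(A_i)_i$ to the set of values $X\setminus\bigcup_iA_i$,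 with domain all $(A_i)_i$ such that every $A_i$ has empty interior. $\mathsf{BCT}_{1,X}:\subseteq\mathcal A_-(X)^{\mathbb N}\rightrightarrows\mathbb N$ and $\mathsf{BCT}_{3,X}:\subseteq\mathcal A_+(X)^{\mathbb N}\rightrightarrows\mathbb N$ both map $(A_i)_i$ to $\{i\in\mathbb N:A_i^\circ\ne\emptyset\}$, with domain all $(A_i)_i$ with $X=\bigcup_iA_i$. Cluster point problem. $\mathsf{CL}_{\mathbb N}:\subseteq\mathbb N^{\mathbb N}\rightrightarrows\mathbb N$ maps a sequence $(x_n)_n$ of natural numbers to its set of cluster points (numbers occurring infinitely often), with domain all sequences having a cluster point. *)

theory Defs
  imports "HOL-Analysis.Analysis" "HOL-Library.Nat_Bijection" "HOL-Library.Countable"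
begin

section \<open>Computable partial functions on Baire space\<close>

type_synonym baire = "nat \<Rightarrow> nat"

definition pair_partial :: "(nat \<rightharpoonup> nat) \<Rightarrow> (nat \<rightharpoonup> nat) \<Rightarrow> (nat \<rightharpoonup> nat)" where
  "pair_partial f g n =
     Option.bind (f n) (\<lambda>a. Option.bind (g n) (\<lambda>b. Some (prod_encode (a, b))))"

definition primrec_partial :: "(nat \<rightharpoonup> nat) \<Rightarrow> (nat \<rightharpoonup> nat) \<Rightarrow> (nat \<rightharpoonup> nat)" where
  "primrec_partial f g n =
     (case prod_decode n of (a, m) \<Rightarrow>
        rec_nat (f a)
          (\<lambda>y r. Option.bind r (\<lambda>i. g (prod_encode (a, prod_encode (y, i))))) m)"

definition minimize_partial :: "(nat \<rightharpoonup> nat) \<Rightarrow> (nat \<rightharpoonup> nat)" where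
  "minimize_partial f a =
     (let stops = (\<lambda>m. f (prod_encode (a, m)) = Some 0 \<and>
                      (\<forall>k<m. \<exists>v. f (prod_encode (a, k)) = Some (Suc v)))
      in if \<exists>m. stops m then Some (LEAST m. stops m) else None)"

text \<open>
  Partial recursive functions of one number argument relative to a point of Baire space,
  uniformly in that point: if \<open>F\<close> is generated by the clauses below, then \<open>F p n = Some m\<close> says
  that a machine with access to the values of \<open>p\<close> halts on input \<open>n\<close> with output \<open>m\<close>. Several
  arguments are coded by the Cantor pairing \<^const>\<open>prod_encode\<close>, so Kleene's schemata take a
  unary form. A type-2 machine computing \<open>p \<mapsto> q\<close> amounts to such an \<open>F\<close> with
  \<open>F p n = Some (q n)\<close> for all \<open>n\<close>.
\<close>

inductive recursive_functional :: "(baire \<Rightarrow> nat \<rightharpoonup> nat) \<Rightarrow> bool" where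
  zero: "recursive_functional (\<lambda>p n. Some 0)"
| succ: "recursive_functional (\<lambda>p n. Some (Suc n))"
| left: "recursive_functional (\<lambda>p n. Some (fst (prod_decode n)))"
| right: "recursive_functional (\<lambda>p n. Some (snd (prod_decode n)))"
| query: "recursive_functional (\<lambda>p n. Some (p n))"
| pair: "recursive_functional F \<Longrightarrow> recursive_functional G \<Longrightarrow>
    recursive_functional (\<lambda>p. pair_partial (F p) (G p))"
| comp: "recursive_functional F \<Longrightarrow> recursive_functional G \<Longrightarrow>
    recursive_functional (\<lambda>p. F p \<circ>\<^sub>m G p)"
| prim_rec: "recursive_functional F \<Longrightarrow> recursive_functional G \<Longrightarrow>
    recursive_functional (\<lambda>p. primrec_partial (F p) (G p))"
| minimize: "recursive_functional F \<Longrightarrow>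
    recursive_functional (\<lambda>p. minimize_partial (F p))"

text \<open>
  The machine has to be correct on the domain of \<open>F\<close>; what it does outside of the domain is
  irrelevant (as usual for computability of partial functions between represented spaces).
\<close>

definition computable_baire :: "(baire \<rightharpoonup> baire) \<Rightarrow> bool" where
  "computable_baire F \<longleftrightarrow>
     (\<exists>M. recursive_functional M \<and> (\<forall>p q. F p = Some q \<longrightarrow> (\<forall>n. M p n = Some (q n))))"


section \<open>Represented spaces, multi-valued functions, strong Weihrauch reducibility\<close>

text \<open>
  A represented space is given by its representation \<open>\<delta>\<close>; the underlying set is \<^term>\<open>ran \<delta>\<close>.
\<close>

type_synonym 'a rep = "baire \<rightharpoonup> 'a"

record ('a, 'b) problem =
  in_rep :: "'a rep"
  out_rep :: "'b rep"
  pdom :: "'a set"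
  vals :: "'a \<Rightarrow> 'b set"

definition realizes :: "(baire \<rightharpoonup> baire) \<Rightarrow> ('a, 'b) problem \<Rightarrow> bool" (infix \<open>\<turnstile>\<^sub>r\<close> 50) where
  "F \<turnstile>\<^sub>r f \<longleftrightarrow>
     (\<forall>p x. in_rep f p = Some x \<and> x \<in> pdom f \<longrightarrow>
        (\<exists>q y. F p = Some q \<and> out_rep f q = Some y \<and> y \<in> vals f x))"

definition sW_le :: "('a, 'b) problem \<Rightarrow> ('c, 'd) problem \<Rightarrow> bool" (infix \<open>\<le>\<^sub>s\<^sub>W\<close> 50) where
  "f \<le>\<^sub>s\<^sub>W g \<longleftrightarrow>
     (\<exists>K H. computable_baire K \<and> computable_baire H \<and>
        (\<forall>G. G \<turnstile>\<^sub>r g \<longrightarrow> (H \<circ>\<^sub>m G \<circ>\<^sub>m K) \<turnstile>\<^sub>r f))"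

definition sW_equiv :: "('a, 'b) problem \<Rightarrow> ('c, 'd) problem \<Rightarrow> bool" (infix \<open>\<equiv>\<^sub>s\<^sub>W\<close> 50) where
  "f \<equiv>\<^sub>s\<^sub>W g \<longleftrightarrow> f \<le>\<^sub>s\<^sub>W g \<and> g \<le>\<^sub>s\<^sub>W f"

definition computable_map :: "'a rep \<Rightarrow> 'b rep \<Rightarrow> ('a \<Rightarrow> 'b) \<Rightarrow> bool" where
  "computable_map \<delta> \<epsilon> f \<longleftrightarrow>
     (\<exists>F. computable_baire F \<and>
        F \<turnstile>\<^sub>r \<lparr>in_rep = \<delta>, out_rep = \<epsilon>, pdom = UNIV, vals = (\<lambda>x. {f x})\<rparr>)"

text \<open>\<open>seq_proj p i\<close> is the component \<open>p\<^sub>i\<close> of \<open>p = \<langle>p\<^sub>0, p\<^sub>1, \<dots>\<rangle>\<close>.\<close>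

definition seq_proj :: "baire \<Rightarrow> nat \<Rightarrow> baire" where
  "seq_proj p i = (\<lambda>j. p (prod_encode (i, j)))"

definition nat_rep :: "nat rep" where
  "nat_rep p = Some (p 0)"

definition prod_rep :: "'a rep \<Rightarrow> 'b rep \<Rightarrow> ('a \<times> 'b) rep" where
  "prod_rep \<delta> \<epsilon> p =
     Option.bind (\<delta> (\<lambda>n. p (2 * n))) (\<lambda>x.
     Option.bind (\<epsilon> (\<lambda>n. p (2 * n + 1))) (\<lambda>y. Some (x, y)))"

definition seq_rep :: "'a rep \<Rightarrow> (nat \<Rightarrow> 'a) rep" where
  "seq_rep \<delta> p =
     (if \<forall>i. seq_proj p i \<in> dom \<delta> then Some (\<lambda>i. the (\<delta> (seq_proj p i))) else None)"


section \<open>The jump\<close>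

text \<open>
  The limit is taken in the library's product topology on \<^typ>\<open>nat \<Rightarrow> nat\<close>.
\<close>

definition lim_baire :: "baire \<rightharpoonup> baire" where
  "lim_baire p =
     (if \<exists>q. seq_proj p \<longlonglongrightarrow> q then Some (THE q. seq_proj p \<longlonglongrightarrow> q) else None)"

definition jump :: "('a, 'b) problem \<Rightarrow> ('a, 'b) problem" where
  "jump f = f\<lparr>in_rep := in_rep f \<circ>\<^sub>m lim_baire\<rparr>"


section \<open>Computable metric spaces\<close>

text \<open>
  The Cauchy representation is parametrised by a carrier set \<open>X\<close>, a distance function \<open>d\<close> and a
  dense sequence \<open>\<alpha>\<close>. Convergence is spelled out through \<open>d\<close> because it is also used below for
  \<open>X \<squnion> {\<infinity>}\<close>.
\<close>

definition cauchy_name ::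
  "'a set \<Rightarrow> ('a \<Rightarrow> 'a \<Rightarrow> real) \<Rightarrow> (nat \<Rightarrow> 'a) \<Rightarrow> baire \<Rightarrow> 'a \<Rightarrow> bool" where
  "cauchy_name X d \<alpha> p x \<longleftrightarrow>
     x \<in> X \<and> (\<lambda>n. d (\<alpha> (p n)) x) \<longlonglongrightarrow> 0 \<and>
     (\<forall>k. \<forall>n\<ge>k. d (\<alpha> (p n)) (\<alpha> (p k)) < (1/2) ^ k)"

definition cauchy_rep :: "'a set \<Rightarrow> ('a \<Rightarrow> 'a \<Rightarrow> real) \<Rightarrow> (nat \<Rightarrow> 'a) \<Rightarrow> 'a rep" where
  "cauchy_rep X d \<alpha> p =
     (if \<exists>x. cauchy_name X d \<alpha> p x then Some (THE x. cauchy_name X d \<alpha> p x) else None)"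

definition real_rep :: "real rep" where
  "real_rep = cauchy_rep UNIV dist (\<lambda>n. of_rat (nat_to_rat_surj n))"

definition computable_metric_space ::
  "'a set \<Rightarrow> ('a \<Rightarrow> 'a \<Rightarrow> real) \<Rightarrow> (nat \<Rightarrow> 'a) \<Rightarrow> bool" where
  "computable_metric_space X d \<alpha> \<longleftrightarrow>
     Metric_space X d \<and> range \<alpha> \<subseteq> X \<and>
     Metric_space.mtopology X d closure_of range \<alpha> = X \<and>
     computable_map (prod_rep nat_rep nat_rep) real_rep (\<lambda>(i, j). d (\<alpha> i) (\<alpha> j))"

definition computable_Polish_space ::
  "'a set \<Rightarrow> ('a \<Rightarrow> 'a \<Rightarrow> real) \<Rightarrow> (nat \<Rightarrow> 'a) \<Rightarrow> bool" where
  "computable_Polish_space X d \<alpha> \<longleftrightarrow>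
     computable_metric_space X d \<alpha> \<and> Metric_space.mcomplete X d"

definition perfect_space :: "'a set \<Rightarrow> ('a \<Rightarrow> 'a \<Rightarrow> real) \<Rightarrow> bool" where
  "perfect_space X d \<longleftrightarrow> (\<forall>x\<in>X. \<not> openin (Metric_space.mtopology X d) {x})"

text \<open>
  \<open>X \<squnion> {\<infinity>}\<close> lives in \<^typ>\<open>'a option\<close>, with \<^const>\<open>None\<close> as the point \<open>\<infinity>\<close>, which also gets
  index \<open>0\<close> in the dense sequence. If \<open>X\<close> has diameter greater than \<open>2\<close>, then putting \<open>\<infinity>\<close> at
  distance \<open>1\<close> from all points violates the triangle inequality. This is harmless: the Cauchy
  representation only uses convergence and the rate condition, by which all points
  \<open>\<alpha> (p n)\<close> of a name lie within distance less than \<open>1\<close> of \<open>\<alpha> (p 0)\<close>, so that a name either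
  is constantly \<open>\<infinity>\<close> or never meets \<open>\<infinity>\<close>.
\<close>

definition add_inf :: "'a set \<Rightarrow> 'a option set" where
  "add_inf X = insert None (Some ` X)"

fun dist_inf :: "('a \<Rightarrow> 'a \<Rightarrow> real) \<Rightarrow> 'a option \<Rightarrow> 'a option \<Rightarrow> real" where
  "dist_inf d (Some x) (Some y) = d x y"
| "dist_inf d None None = 0"
| "dist_inf d None (Some y) = 1"
| "dist_inf d (Some x) None = 1"

definition dense_inf :: "(nat \<Rightarrow> 'a) \<Rightarrow> nat \<Rightarrow> 'a option" where
  "dense_inf \<alpha> = case_nat None (\<lambda>n. Some (\<alpha> n))"

definition cauchy_rep_inf :: "'a set \<Rightarrow> ('a \<Rightarrow> 'a \<Rightarrow> real) \<Rightarrow> (nat \<Rightarrow> 'a) \<Rightarrow> 'a option rep" where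
  "cauchy_rep_inf X d \<alpha> = cauchy_rep (add_inf X) (dist_inf d) (dense_inf \<alpha>)"


section \<open>Hyperspaces of closed subsets\<close>

text \<open>
  The enumeration \<^const>\<open>nat_to_rat_surj\<close> includes the rationals \<open>\<le> 0\<close>, for which the ball is
  empty.
\<close>

definition rational_ball ::
  "'a set \<Rightarrow> ('a \<Rightarrow> 'a \<Rightarrow> real) \<Rightarrow> (nat \<Rightarrow> 'a) \<Rightarrow> nat \<Rightarrow> 'a set" where
  "rational_ball X d \<alpha> m =
     (case prod_decode m of (n, k) \<Rightarrow>
        Metric_space.mball X d (\<alpha> n) (of_rat (nat_to_rat_surj k)))"

definition psi_minus :: "'a set \<Rightarrow> ('a \<Rightarrow> 'a \<Rightarrow> real) \<Rightarrow> (nat \<Rightarrow> 'a) \<Rightarrow> 'a set rep" where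
  "psi_minus X d \<alpha> p = Some (X - (\<Union>i. rational_ball X d \<alpha> (p i)))"

text \<open>
  Since \<open>\<infinity>\<close> is isolated, intersecting the closure of \<open>{x\<^sub>n}\<close> in \<open>X \<squnion> {\<infinity>}\<close> with \<open>X\<close> amounts to
  taking the closure in \<open>X\<close> of those \<open>x\<^sub>n\<close> that are different from \<open>\<infinity>\<close>.
\<close>

definition psi_plus :: "'a set \<Rightarrow> ('a \<Rightarrow> 'a \<Rightarrow> real) \<Rightarrow> (nat \<Rightarrow> 'a) \<Rightarrow> 'a set rep" where
  "psi_plus X d \<alpha> p =
     map_option (\<lambda>x. Metric_space.mtopology X d closure_of {a. Some a \<in> range x})
       (seq_rep (cauchy_rep_inf X d \<alpha>) p)"


section \<open>Baire category problems and the cluster point problem\<close>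

definition nowhere_dense_seqs :: "'a set \<Rightarrow> ('a \<Rightarrow> 'a \<Rightarrow> real) \<Rightarrow> (nat \<Rightarrow> 'a set) set" where
  "nowhere_dense_seqs X d =
     {A. \<forall>i. closedin (Metric_space.mtopology X d) (A i) \<and>
             Metric_space.mtopology X d interior_of A i = {}}"

definition closed_cover_seqs :: "'a set \<Rightarrow> ('a \<Rightarrow> 'a \<Rightarrow> real) \<Rightarrow> (nat \<Rightarrow> 'a set) set" where
  "closed_cover_seqs X d =
     {A. (\<forall>i. closedin (Metric_space.mtopology X d) (A i)) \<and> X = (\<Union>i. A i)}"

definition BCT0 ::
  "'a set \<Rightarrow> ('a \<Rightarrow> 'a \<Rightarrow> real) \<Rightarrow> (nat \<Rightarrow> 'a) \<Rightarrow> (nat \<Rightarrow> 'a set, 'a) problem" where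
  "BCT0 X d \<alpha> =
     \<lparr>in_rep = seq_rep (psi_minus X d \<alpha>), out_rep = cauchy_rep X d \<alpha>,
      pdom = nowhere_dense_seqs X d, vals = (\<lambda>A. X - (\<Union>i. A i))\<rparr>"

definition BCT1 ::
  "'a set \<Rightarrow> ('a \<Rightarrow> 'a \<Rightarrow> real) \<Rightarrow> (nat \<Rightarrow> 'a) \<Rightarrow> (nat \<Rightarrow> 'a set, nat) problem" where
  "BCT1 X d \<alpha> =
     \<lparr>in_rep = seq_rep (psi_minus X d \<alpha>), out_rep = nat_rep,
      pdom = closed_cover_seqs X d,
      vals = (\<lambda>A. {i. Metric_space.mtopology X d interior_of A i \<noteq> {}})\<rparr>"

definition BCT2 ::
  "'a set \<Rightarrow> ('a \<Rightarrow> 'a \<Rightarrow> real) \<Rightarrow> (nat \<Rightarrow> 'a) \<Rightarrow> (nat \<Rightarrow> 'a set, 'a) problem" where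
  "BCT2 X d \<alpha> =
     \<lparr>in_rep = seq_rep (psi_plus X d \<alpha>), out_rep = cauchy_rep X d \<alpha>,
      pdom = nowhere_dense_seqs X d, vals = (\<lambda>A. X - (\<Union>i. A i))\<rparr>"

definition BCT3 ::
  "'a set \<Rightarrow> ('a \<Rightarrow> 'a \<Rightarrow> real) \<Rightarrow> (nat \<Rightarrow> 'a) \<Rightarrow> (nat \<Rightarrow> 'a set, nat) problem" where
  "BCT3 X d \<alpha> =
     \<lparr>in_rep = seq_rep (psi_plus X d \<alpha>), out_rep = nat_rep,
      pdom = closed_cover_seqs X d,
      vals = (\<lambda>A. {i. Metric_space.mtopology X d interior_of A i \<noteq> {}})\<rparr>"

text \<open>Baire space itself is represented by the identity.\<close>

definition CL_nat :: "(baire, nat) problem" where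
  "CL_nat =
     \<lparr>in_rep = Some, out_rep = nat_rep,
      pdom = {x. \<exists>k. infinite {n. x n = k}}, vals = (\<lambda>x. {k. infinite {n. x n = k}})\<rparr>"

end

theory Submission
  imports Defs
begin

text \<open>
  A limit name of a closed set \<open>A\<close> with negative information is a
  sequence of enumerations that converges to an enumeration of balls with union \<open>X - A\<close>; a name
  with positive information enumerates a dense sequence of points of \<open>A\<close>. Two conversions between
  these kinds of information carry the theorem.

  From positive information to limits of negative information: whether a given ball contains an
  enumerated point is semidecidable, so at stage \<open>s\<close> one lists all balls in which no point has been
  found within \<open>s\<close> steps and replaces the other balls by an empty one. In the limit exactly
  the balls disjoint from \<open>A\<close> remain (\<open>psi_plus_to_limit_psi_minus\<close>). As the set itself is
  unchanged, this single translation reduces \<open>BCT\<^sub>2\<close> to \<open>BCT\<^sub>0'\<close> and \<open>BCT\<^sub>3\<close> to \<open>BCT\<^sub>1'\<close>.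

  From limits of negative information to positive information one cannot keep the set, but for
  \<open>BCT\<^sub>0'\<close> it is enough to find a larger set that is still nowhere dense. Call the ball of radius
  \<open>2\<^sup>-\<^sup>l\<close> around \<open>\<alpha> m\<close> undecided if none of the first \<open>l + 1\<close> balls listed at stage \<open>l\<close> both stays in
  the list forever and formally contains it. This is semidecidable, and every ball that
  meets \<open>A\<close> is undecided (\<open>undecided_near_complement\<close>). Enumerating one point near each undecided
  ball thus approximates all points of \<open>A\<close>. Conversely, near a point outside of \<open>A\<close> all balls of
  sufficiently high level \<open>l\<close> are decided, so only finitely many levels contribute points there.
  If on each level the points are taken from a locally finite cover (\<open>cell\<close>), then locally
  only finitely many points are added, and in a perfect space they do not fill an open set
  (\<open>undecided_nowhere_dense\<close>).

  For the discrete problems the circle \<open>BCT\<^sub>3 \<le> BCT\<^sub>1' \<le> CL \<le> BCT\<^sub>3\<close> is closed as follows. For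
  \<open>BCT\<^sub>1'\<close>, ``the ball with centre \<open>\<alpha> n\<close> and radius \<open>2\<^sup>-\<^sup>k\<close> lies in \<open>A\<^sub>i\<close>'' is a \<open>\<Pi>\<^sub>2\<close> property of
  \<open>(i, n, k)\<close> and the converging sequence, and the triples with a \<open>\<Pi>\<^sub>2\<close> property can be made
  the cluster points of a computable sequence (\<open>cluster_points_of_Pi2\<close>); the Baire category theorem
  provides at least one such triple. To solve \<open>CL\<close>, let \<open>A\<^sub>k\<close> collect more and more of the dense sequence each
  time \<open>k\<close> occurs: then \<open>A\<^sub>k = X\<close> for a cluster point \<open>k\<close>, and \<open>A\<^sub>k\<close> is finite, hence without interior,
  otherwise.

  All translations are total recursive functionals. To verify this without programming machines, three
  classes are closed under the operations used: decidable predicates, semidecidable predicates, and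
  families of real numbers with computable dyadic approximations. Strict inequalities between
  the latter are semidecidable, and the distances of points of the dense sequence belong to
  them because the oracle of a recursive functional can be replaced by a computed one
  (\<open>recursive_functional_oracle_substitution\<close>).
\<close>

section \<open>Recursive functionals\<close>

abbreviation code_pair :: "nat \<Rightarrow> nat \<Rightarrow> nat" (\<open>\<langle>_,/ _\<rangle>\<close>) where
  "\<langle>a, b\<rangle> \<equiv> prod_encode (a, b)"

abbreviation pfst :: "nat \<Rightarrow> nat" where "pfst n \<equiv> fst (prod_decode n)"

abbreviation psnd :: "nat \<Rightarrow> nat" where "psnd n \<equiv> snd (prod_decode n)"

lemma pfst_psnd [simp]: "\<langle>pfst n, psnd n\<rangle> = n"
  by simp

definition total_recursive :: "(baire \<Rightarrow> nat \<Rightarrow> nat) \<Rightarrow> bool" where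
  "total_recursive f \<longleftrightarrow> recursive_functional (\<lambda>p n. Some (f p n))"

named_theorems computability

lemma total_recursive_compose:
  assumes "total_recursive f" "total_recursive g"
  shows "total_recursive (\<lambda>p n. f p (g p n))"
  using recursive_functional.comp[OF assms[unfolded total_recursive_def]]
  by (simp add: total_recursive_def map_comp_def)

lemma total_recursive_pair [computability]:
  assumes "total_recursive f" "total_recursive g"
  shows "total_recursive (\<lambda>p n. \<langle>f p n, g p n\<rangle>)"
  using recursive_functional.pair[OF assms[unfolded total_recursive_def]]
  by (simp add: total_recursive_def pair_partial_def[abs_def])

lemma total_recursive_fst [computability]:
  assumes "total_recursive f"
  shows "total_recursive (\<lambda>p n. pfst (f p n))"
  by (rule total_recursive_compose[OF recursive_functional.left[folded total_recursive_def] assms])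

lemma total_recursive_snd [computability]:
  assumes "total_recursive f"
  shows "total_recursive (\<lambda>p n. psnd (f p n))"
  by (rule total_recursive_compose[OF recursive_functional.right[folded total_recursive_def] assms])

lemma total_recursive_id [computability]: "total_recursive (\<lambda>p n. n)"
proof -
  have "total_recursive (\<lambda>p n. \<langle>pfst n, psnd n\<rangle>)"
    using recursive_functional.left recursive_functional.right
    by (intro total_recursive_pair) (simp_all add: total_recursive_def)
  then show ?thesis by simp
qed

lemma total_recursive_query [computability]:
  assumes "total_recursive f"
  shows "total_recursive (\<lambda>p n. p (f p n))"
  by (rule total_recursive_compose[OF recursive_functional.query[folded total_recursive_def] assms])

lemma total_recursive_Suc [computability]:
  assumes "total_recursive f"
  shows "total_recursive (\<lambda>p n. Suc (f p n))"
  by (rule total_recursive_compose[OF recursive_functional.succ[folded total_recursive_def] assms])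

lemma total_recursive_const [computability]: "total_recursive (\<lambda>p n. c)"
proof (induction c)
  case 0
  show ?case using recursive_functional.zero by (simp add: total_recursive_def)
qed (rule total_recursive_Suc)

lemma total_recursive_rec [computability]:
  assumes b: "total_recursive b" and m: "total_recursive m"
    and s: "total_recursive (\<lambda>p x. s p (pfst x) (pfst (psnd x)) (psnd (psnd x)))"
  shows "total_recursive (\<lambda>p n. rec_nat (b p n) (\<lambda>y r. s p n y r) (m p n))"
proof -
  have "(rec_nat (Some (b p a)) (\<lambda>y r. Option.bind r (\<lambda>i. Some (s p a y i))) k)
      = Some (rec_nat (b p a) (s p a) k)" for p a k
    by (induction k) auto
  then have "total_recursive (\<lambda>p x. rec_nat (b p (pfst x)) (\<lambda>y r. s p (pfst x) y r) (psnd x))"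
    using recursive_functional.prim_rec[OF assms(1,3)[unfolded total_recursive_def]]
    by (simp add: total_recursive_def primrec_partial_def[abs_def] case_prod_unfold)
  from total_recursive_compose[OF this total_recursive_pair[OF total_recursive_id m]]
  show ?thesis by simp
qed

lemma total_recursive_pred:
  assumes "total_recursive f"
  shows "total_recursive (\<lambda>p n. f p n - 1)"
proof -
  have "rec_nat 0 (\<lambda>y r. y) m = m - 1" for m :: nat
    by (cases m) auto
  moreover have "total_recursive (\<lambda>p n. rec_nat 0 (\<lambda>y r. y) (f p n))"
    by (intro computability assms)
  ultimately show ?thesis by simp
qed

lemma total_recursive_add [computability]:
  assumes "total_recursive f" "total_recursive g"
  shows "total_recursive (\<lambda>p n. f p n + g p n)"
proof -
  have "rec_nat a (\<lambda>y r. Suc r) m = a + m" for a m :: nat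
    by (induction m) auto
  moreover have "total_recursive (\<lambda>p n. rec_nat (f p n) (\<lambda>y r. Suc r) (g p n))"
    by (intro computability assms)
  ultimately show ?thesis by simp
qed

lemma total_recursive_diff [computability]:
  assumes "total_recursive f" "total_recursive g"
  shows "total_recursive (\<lambda>p n. f p n - g p n)"
proof -
  have "rec_nat a (\<lambda>y r. r - 1) m = a - m" for a m :: nat
    by (induction m) auto
  moreover have "total_recursive (\<lambda>p n. rec_nat (f p n) (\<lambda>y r. r - 1) (g p n))"
    by (intro computability assms total_recursive_pred)
  ultimately show ?thesis by simp
qed

lemma total_recursive_mult [computability]:
  assumes "total_recursive f" "total_recursive g"
  shows "total_recursive (\<lambda>p n. f p n * g p n)"
proof -
  have "rec_nat 0 (\<lambda>y r. r + a) m = a * m" for a m :: nat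
    by (induction m) auto
  moreover have "total_recursive (\<lambda>p n. rec_nat 0 (\<lambda>y r. r + f p n) (g p n))"
    by (intro computability total_recursive_compose[OF assms(1)] assms)
  ultimately show ?thesis by simp
qed

lemma total_recursive_power2 [computability]:
  assumes "total_recursive f"
  shows "total_recursive (\<lambda>p n. 2 ^ f p n)"
proof -
  have "rec_nat (Suc 0) (\<lambda>y r. 2 * r) m = (2::nat) ^ m" for m :: nat
    by (induction m) auto
  moreover have "total_recursive (\<lambda>p n. rec_nat (Suc 0) (\<lambda>y r. 2 * r) (f p n))"
    by (intro computability assms)
  ultimately show ?thesis by simp
qed

definition decidable :: "(baire \<Rightarrow> nat \<Rightarrow> bool) \<Rightarrow> bool" where
  "decidable P \<longleftrightarrow> total_recursive (\<lambda>p n. of_bool (P p n))"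

lemma decidable_compose:
  assumes "decidable P" "total_recursive g"
  shows "decidable (\<lambda>p n. P p (g p n))"
  using assms unfolding decidable_def by (rule total_recursive_compose)

lemma total_recursive_if [computability]:
  assumes "decidable P" "total_recursive f" "total_recursive g"
  shows "total_recursive (\<lambda>p n. if P p n then f p n else g p n)"
proof -
  have "total_recursive (\<lambda>p n. rec_nat (g p n) (\<lambda>_ _. f p n) (of_bool (P p n)))"
    by (intro computability total_recursive_compose[OF assms(2)] assms assms[unfolded decidable_def])
  also have "(\<lambda>p n. rec_nat (g p n) (\<lambda>_ _. f p n) (of_bool (P p n)))
      = (\<lambda>p n. if P p n then f p n else g p n)"
    by (auto simp: fun_eq_iff)
  finally show ?thesis .
qed

lemma decidable_le [computability]:
  assumes "total_recursive f" "total_recursive g"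
  shows "decidable (\<lambda>p n. f p n \<le> g p n)"
proof -
  have "total_recursive (\<lambda>p n. 1 - (f p n - g p n))"
    by (intro computability assms)
  also have "(\<lambda>p n. 1 - (f p n - g p n)) = (\<lambda>p n. of_bool (f p n \<le> g p n))"
    by (auto simp: fun_eq_iff)
  finally show ?thesis by (simp add: decidable_def)
qed

lemma decidable_not [computability]:
  assumes "decidable P"
  shows "decidable (\<lambda>p n. \<not> P p n)"
proof -
  have "total_recursive (\<lambda>p n. 1 - of_bool (P p n))"
    by (intro computability assms assms[unfolded decidable_def])
  also have "(\<lambda>p n. 1 - of_bool (P p n) :: nat) = (\<lambda>p n. of_bool (\<not> P p n))"
    by (auto simp: fun_eq_iff)
  finally show ?thesis by (simp add: decidable_def)
qed

lemma decidable_conj [computability]: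
  assumes "decidable P" "decidable Q"
  shows "decidable (\<lambda>p n. P p n \<and> Q p n)"
proof -
  have "total_recursive (\<lambda>p n. of_bool (P p n) * of_bool (Q p n))"
    by (intro computability assms assms[unfolded decidable_def])
  also have "(\<lambda>p n. of_bool (P p n) * of_bool (Q p n) :: nat) = (\<lambda>p n. of_bool (P p n \<and> Q p n))"
    by (auto simp: fun_eq_iff)
  finally show ?thesis by (simp add: decidable_def)
qed

lemma decidable_disj [computability]:
  assumes "decidable P" "decidable Q"
  shows "decidable (\<lambda>p n. P p n \<or> Q p n)"
  using decidable_not[OF decidable_conj[OF assms[THEN decidable_not]]] by simp

lemma decidable_less [computability]:
  assumes "total_recursive f" "total_recursive g"
  shows "decidable (\<lambda>p n. f p n < g p n)"
  using decidable_not[OF decidable_le[OF assms(2,1)]] by (simp add: not_le)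

lemma decidable_eq [computability]:
  assumes "total_recursive f" "total_recursive g"
  shows "decidable (\<lambda>p n. f p n = g p n)"
  using decidable_conj[OF decidable_le[OF assms] decidable_le[OF assms(2,1)]]
  by (simp add: eq_iff)

lemma decidable_bounded_ex [computability]:
  assumes "decidable (\<lambda>p x. P p (pfst x) (psnd x))" "total_recursive m"
  shows "decidable (\<lambda>p n. \<exists>k<m p n. P p n k)"
proof -
  have "rec_nat (0::nat) (\<lambda>y r. if P p n y then 1 else r) k = of_bool (\<exists>i<k. P p n i)" for p n and k :: nat
    by (induction k) (auto simp: less_Suc_eq)
  moreover have "total_recursive (\<lambda>p n. rec_nat 0 (\<lambda>y r. if P p n y then 1 else r) (m p n))"
  proof (intro computability assms)
    show "decidable (\<lambda>p x. P p (pfst x) (pfst (psnd x)))"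
      using decidable_compose[OF assms(1), of "\<lambda>p x. \<langle>pfst x, pfst (psnd x)\<rangle>"]
      by (simp add: computability)
  qed
  ultimately show ?thesis by (simp add: decidable_def)
qed

lemma decidable_bounded_all [computability]:
  assumes "decidable (\<lambda>p x. P p (pfst x) (psnd x))" "total_recursive m"
  shows "decidable (\<lambda>p n. \<forall>k<m p n. P p n k)"
  using decidable_not[OF decidable_bounded_ex[OF decidable_not[OF assms(1)] assms(2)]] by simp

lemma total_recursive_div [computability]:
  assumes "total_recursive f" "total_recursive g"
  shows "total_recursive (\<lambda>p n. f p n div g p n)"
proof -
  \<comment> \<open>The quotient is the largest \<open>q \<le> a\<close> with \<open>q * b \<le> a\<close>.\<close>
  have *: "rec_nat 0 (\<lambda>y r. if Suc y * b \<le> a then Suc y else r) k = (if k * b \<le> a then k else a div b)"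
    if "b > 0" for a b k :: nat
  proof (induction k)
    case (Suc k)
    have "a div b = k" if "k * b \<le> a" "\<not> Suc k * b \<le> a"
      using that \<open>b > 0\<close> by (intro div_nat_eqI) (auto simp: mult.commute)
    moreover have "Suc k * b \<le> a \<Longrightarrow> k * b \<le> a" by simp
    ultimately show ?case using Suc by auto
  qed auto
  have **: "(if b = 0 then 0 else rec_nat 0 (\<lambda>y r. if Suc y * b \<le> a then Suc y else r) a) = a div b"
    for a b :: nat
  proof -
    have "a = a div b" if "b > 0" "a * b \<le> a"
    proof -
      have "b = 1 \<or> a = 0"
        using that by (auto simp: le_Suc_eq)
      then show ?thesis by auto
    qed
    with * show ?thesis by (cases "b = 0") auto
  qed
  have "total_recursive (\<lambda>p n. if g p n = 0 then 0
      else rec_nat 0 (\<lambda>y r. if Suc y * g p n \<le> f p n then Suc y else r) (f p n))"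
    by (intro computability assms total_recursive_compose[OF assms(1)]
        total_recursive_compose[OF assms(2)])
  then show ?thesis by (simp only: **)
qed

lemma recursive_functional_compose:
  assumes "recursive_functional F" "total_recursive h"
  shows "recursive_functional (\<lambda>p n. F p (h p n))"
  using recursive_functional.comp[OF assms(1) assms(2)[unfolded total_recursive_def]]
  by (simp add: map_comp_def)

text \<open>
  A machine never sees more of its oracle than the answers to its queries, so answering them
  by a subcomputation \<open>Q\<close>, which may depend on a parameter \<open>a\<close>, is again a computation. The induction
  threads \<open>a\<close> through all schemata. As the answers are needed to be defined only for the
  parameter at hand, the lemma covers both a uniform family of oracles and the composition of
  partial functions on Baire space.
\<close>

lemma recursive_functional_oracle_substitution:
  assumes "recursive_functional M" and Q: "recursive_functional Q"
  shows "\<exists>N. recursive_functional N \<and>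
    (\<forall>p a q. (\<forall>n. Q p \<langle>a, n\<rangle> = Some (q n)) \<longrightarrow> (\<forall>x. N p \<langle>a, x\<rangle> = M q x))"
    (is "\<exists>N. recursive_functional N \<and> ?substitutes N M")
  using assms(1)
proof induction
  case zero
  show ?case
    by (intro exI[of _ "\<lambda>p x. Some 0"]) (simp add: recursive_functional.zero)
next
  case succ
  have "total_recursive (\<lambda>p x. Suc (psnd x))" by (intro computability)
  then show ?case
    by (intro exI[of _ "\<lambda>p x. Some (Suc (psnd x))"]) (simp add: total_recursive_def)
next
  case left
  have "total_recursive (\<lambda>p x. pfst (psnd x))" by (intro computability)
  then show ?case
    by (intro exI[of _ "\<lambda>p x. Some (pfst (psnd x))"]) (simp add: total_recursive_def)
next
  case right
  have "total_recursive (\<lambda>p x. psnd (psnd x))" by (intro computability)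
  then show ?case
    by (intro exI[of _ "\<lambda>p x. Some (psnd (psnd x))"]) (simp add: total_recursive_def)
next
  case query
  show ?case
    using Q by blast
next
  case (pair F G)
  then obtain NF NG where N: "recursive_functional NF" "recursive_functional NG"
    and *: "?substitutes NF F" "?substitutes NG G"
    by blast
  have "pair_partial (NF p) (NG p) \<langle>a, x\<rangle> = pair_partial (F q) (G q) x"
    if q: "\<forall>n. Q p \<langle>a, n\<rangle> = Some (q n)" for p a q x
    using *[THEN spec, THEN spec, THEN spec, THEN mp, OF q] by (simp add: pair_partial_def)
  with recursive_functional.pair[OF N] show ?case by blast
next
  case (comp F G)
  then obtain NF NG where N: "recursive_functional NF" "recursive_functional NG"
    and *: "?substitutes NF F" "?substitutes NG G"
    by blast
  define N' where "N' = (\<lambda>p. NF p \<circ>\<^sub>m pair_partial (\<lambda>x. Some (pfst x)) (NG p))"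
  have "recursive_functional N'"
    unfolding N'_def
    by (intro recursive_functional.comp recursive_functional.pair N recursive_functional.left)
  moreover have "N' p \<langle>a, x\<rangle> = (F q \<circ>\<^sub>m G q) x"
    if q: "\<forall>n. Q p \<langle>a, n\<rangle> = Some (q n)" for p a q x
    using *[THEN spec, THEN spec, THEN spec, THEN mp, OF q] by (auto simp: N'_def pair_partial_def map_comp_def split: option.split)
  ultimately show ?case by blast
next
  case (prim_rec F G)
  then obtain NF NG where N: "recursive_functional NF" "recursive_functional NG"
    and *: "?substitutes NF F" "?substitutes NG G"
    by blast
  \<comment> \<open>The recursion keeps the new parameter \<open>a\<close> together with the old one \<open>b\<close>, so \<open>\<langle>a, \<langle>b, m\<rangle>\<rangle>\<close>
    has to be regrouped as \<open>\<langle>\<langle>a, b\<rangle>, m\<rangle>\<close>, and back in the step function.\<close>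
  define NG' where "NG' = (\<lambda>p z. NG p \<langle>pfst (pfst z), \<langle>psnd (pfst z), psnd z\<rangle>\<rangle>)"
  define N' where "N' = (\<lambda>p z. primrec_partial (NF p) (NG' p)
      \<langle>\<langle>pfst z, pfst (psnd z)\<rangle>, psnd (psnd z)\<rangle>)"
  have "recursive_functional N'"
    unfolding N'_def NG'_def
    by (intro recursive_functional_compose[OF recursive_functional.prim_rec] N
        recursive_functional_compose[OF N(2)] computability)
  moreover have "N' p \<langle>a, x\<rangle> = primrec_partial (F q) (G q) x"
    if q: "\<forall>n. Q p \<langle>a, n\<rangle> = Some (q n)" for p a q x
    using *[THEN spec, THEN spec, THEN spec, THEN mp, OF q] by (simp add: N'_def NG'_def primrec_partial_def case_prod_unfold)
  ultimately show ?case by blast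
next
  case (minimize F)
  then obtain NF where N: "recursive_functional NF" and *: "?substitutes NF F"
    by blast
  define N' where "N' = (\<lambda>p z. NF p \<langle>pfst (pfst z), \<langle>psnd (pfst z), psnd z\<rangle>\<rangle>)"
  have "recursive_functional (\<lambda>p. minimize_partial (N' p))"
    unfolding N'_def
    by (intro recursive_functional.minimize recursive_functional_compose[OF N] computability)
  moreover have "minimize_partial (N' p) \<langle>a, x\<rangle> = minimize_partial (F q) x"
    if q: "\<forall>n. Q p \<langle>a, n\<rangle> = Some (q n)" for p a q x
    using *[THEN spec, THEN spec, THEN spec, THEN mp, OF q] by (simp add: N'_def minimize_partial_def)
  ultimately show ?case by blast
qed

section \<open>Semidecidable predicates\<close>

definition semidecidable :: "(baire \<Rightarrow> nat \<Rightarrow> bool) \<Rightarrow> bool" where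
  "semidecidable P \<longleftrightarrow> (\<exists>D. decidable D \<and> (\<forall>p n. P p n \<longleftrightarrow> (\<exists>w. D p \<langle>n, w\<rangle>)))"

lemma semidecidableI:
  assumes "decidable D" "\<And>p n. P p n \<longleftrightarrow> (\<exists>w. D p \<langle>n, w\<rangle>)"
  shows "semidecidable P"
  using assms unfolding semidecidable_def by blast

lemma semidecidable_decidable:
  assumes "decidable P"
  shows "semidecidable P"
  by (rule semidecidableI[of "\<lambda>p x. P p (pfst x)"])
    (auto intro!: decidable_compose[OF assms] computability)

lemma semidecidable_ex [computability]:
  assumes "semidecidable (\<lambda>p x. P p (pfst x) (psnd x))"
  shows "semidecidable (\<lambda>p n. \<exists>k. P p n k)"
proof -
  obtain D where D: "decidable D" "\<And>p x. P p (pfst x) (psnd x) \<longleftrightarrow> (\<exists>w. D p \<langle>x, w\<rangle>)"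
    using assms unfolding semidecidable_def by blast
  have *: "P p n k \<longleftrightarrow> (\<exists>w. D p \<langle>\<langle>n, k\<rangle>, w\<rangle>)" for p n k
    using D(2)[of p "\<langle>n, k\<rangle>"] by simp
  have "decidable (\<lambda>p x. D p \<langle>\<langle>pfst x, pfst (psnd x)\<rangle>, psnd (psnd x)\<rangle>)"
    by (intro decidable_compose[OF D(1)] computability)
  then show ?thesis
    by (rule semidecidableI) (simp add: *, metis fst_conv snd_conv prod_encode_inverse)
qed

lemma semidecidable_disj [computability]:
  assumes "semidecidable P" "semidecidable Q"
  shows "semidecidable (\<lambda>p n. P p n \<or> Q p n)"
proof -
  obtain D where D: "decidable D" "\<And>p n. P p n \<longleftrightarrow> (\<exists>w. D p \<langle>n, w\<rangle>)"
    using assms(1) unfolding semidecidable_def by blast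
  obtain E where E: "decidable E" "\<And>p n. Q p n \<longleftrightarrow> (\<exists>w. E p \<langle>n, w\<rangle>)"
    using assms(2) unfolding semidecidable_def by blast
  have "decidable (\<lambda>p x. D p x \<or> E p x)"
    by (intro computability D(1) E(1))
  then show ?thesis
    by (rule semidecidableI) (auto simp add: D(2) E(2))
qed

lemma semidecidable_conj [computability]:
  assumes "semidecidable P" "semidecidable Q"
  shows "semidecidable (\<lambda>p n. P p n \<and> Q p n)"
proof -
  obtain D where D: "decidable D" "\<And>p n. P p n \<longleftrightarrow> (\<exists>w. D p \<langle>n, w\<rangle>)"
    using assms(1) unfolding semidecidable_def by blast
  obtain E where E: "decidable E" "\<And>p n. Q p n \<longleftrightarrow> (\<exists>w. E p \<langle>n, w\<rangle>)"
    using assms(2) unfolding semidecidable_def by blast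
  have "decidable (\<lambda>p x. D p \<langle>pfst x, pfst (psnd x)\<rangle> \<and> E p \<langle>pfst x, psnd (psnd x)\<rangle>)"
    by (intro decidable_conj decidable_compose[OF D(1)] decidable_compose[OF E(1)] computability)
  then show ?thesis
    by (rule semidecidableI) (simp add: D(2) E(2), metis fst_conv snd_conv prod_encode_inverse)
qed

lemma semidecidable_bounded_all [computability]:
  assumes "semidecidable (\<lambda>p x. P p (pfst x) (psnd x))" "total_recursive m"
  shows "semidecidable (\<lambda>p n. \<forall>k<m p n. P p n k)"
proof -
  obtain D where D: "decidable D" "\<And>p x. P p (pfst x) (psnd x) \<longleftrightarrow> (\<exists>w. D p \<langle>x, w\<rangle>)"
    using assms(1) unfolding semidecidable_def by blast
  have P: "P p n k \<longleftrightarrow> (\<exists>w. D p \<langle>\<langle>n, k\<rangle>, w\<rangle>)" for p n k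
    using D(2)[of p "\<langle>n, k\<rangle>"] by simp
  have "decidable (\<lambda>p x. \<forall>k<m p (pfst x). \<exists>w<psnd x. D p \<langle>\<langle>pfst x, k\<rangle>, w\<rangle>)"
    by (intro decidable_bounded_all decidable_bounded_ex decidable_compose[OF D(1)]
        computability total_recursive_compose[OF assms(2)])
  then show ?thesis
  proof (rule semidecidableI)
    fix p n
    have "\<exists>u. \<forall>k<b. \<exists>w<u. D p \<langle>\<langle>n, k\<rangle>, w\<rangle>" if "\<forall>k<b. P p n k" for b
      using that
    proof (induction b)
      case (Suc b)
      then obtain u where u: "\<forall>k<b. \<exists>w<u. D p \<langle>\<langle>n, k\<rangle>, w\<rangle>" by auto
      obtain w where w: "D p \<langle>\<langle>n, b\<rangle>, w\<rangle>" using Suc.prems P by blast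
      have "\<forall>k<Suc b. \<exists>w'<max u (Suc w). D p \<langle>\<langle>n, k\<rangle>, w'\<rangle>"
        using u w by (metis less_SucE less_max_iff_disj lessI)
      then show ?case by blast
    qed auto
    then show "(\<forall>k<m p n. P p n k) \<longleftrightarrow>
        (\<exists>w. \<forall>k<m p (pfst \<langle>n, w\<rangle>). \<exists>v<psnd \<langle>n, w\<rangle>. D p \<langle>\<langle>pfst \<langle>n, w\<rangle>, k\<rangle>, v\<rangle>)"
      using P by (simp, blast)
  qed
qed

text \<open>
  Uniformisation: from a semidecidable relation one can compute, for every \<open>c\<close> that has a solution \<open>z\<close>,
  exactly one of them. The value \<open>h p \<langle>c, w\<rangle>\<close> is \<open>Suc z\<close> if \<open>w\<close> codes the least pair of a solution and
  a proof of it, and \<open>0\<close> otherwise; this keeps \<open>h\<close> total where no solution exists.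
\<close>

lemma semidecidable_choice:
  assumes "semidecidable (\<lambda>p x. P p (pfst x) (psnd x))"
  obtains h where "total_recursive h"
    and "\<And>p c w z. h p \<langle>c, w\<rangle> = Suc z \<Longrightarrow> P p c z"
    and "\<And>p c z. P p c z \<Longrightarrow> \<exists>w z'. h p \<langle>c, w\<rangle> = Suc z'"
    and "\<And>p c v w. h p \<langle>c, v\<rangle> \<noteq> 0 \<Longrightarrow> h p \<langle>c, w\<rangle> \<noteq> 0 \<Longrightarrow> v = w"
proof -
  obtain D where D: "decidable D" "\<And>p x. P p (pfst x) (psnd x) \<longleftrightarrow> (\<exists>w. D p \<langle>x, w\<rangle>)"
    using assms unfolding semidecidable_def by blast
  have P: "P p c z \<longleftrightarrow> (\<exists>w. D p \<langle>\<langle>c, z\<rangle>, w\<rangle>)" for p c z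
    using D(2)[of p "\<langle>c, z\<rangle>"] by simp
  define E where "E = (\<lambda>p c w. D p \<langle>\<langle>c, pfst w\<rangle>, psnd w\<rangle>)"
  define h where "h = (\<lambda>p x. if E p (pfst x) (psnd x) \<and> \<not> (\<exists>v<psnd x. E p (pfst x) v)
      then Suc (pfst (psnd x)) else 0)"
  have "total_recursive h"
    unfolding h_def E_def
    by (intro total_recursive_if decidable_conj decidable_not decidable_bounded_ex
        decidable_compose[OF D(1)] computability)
  moreover have "P p c z" if "h p \<langle>c, w\<rangle> = Suc z" for p c w z
    using that by (auto simp: h_def E_def P split: if_splits)
  moreover have "\<exists>w z'. h p \<langle>c, w\<rangle> = Suc z'" if "P p c z" for p c z
  proof -
    obtain u where u: "D p \<langle>\<langle>c, z\<rangle>, u\<rangle>" using \<open>P p c z\<close> P by blast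
    have "E p c \<langle>z, u\<rangle>" using u by (simp add: E_def)
    then have "E p c (LEAST w. E p c w)" by (rule LeastI)
    then have "h p \<langle>c, LEAST w. E p c w\<rangle> = Suc (pfst (LEAST w. E p c w))"
      by (auto simp: h_def dest: not_less_Least)
    then show ?thesis by blast
  qed
  moreover have "v = w" if "h p \<langle>c, v\<rangle> \<noteq> 0" "h p \<langle>c, w\<rangle> \<noteq> 0" for p c v w
  proof -
    have "E p c v" "E p c w" "\<not> w < v" "\<not> v < w"
      using that by (auto simp: h_def split: if_splits)
    then show ?thesis by simp
  qed
  ultimately show thesis by (rule that)
qed

section \<open>Approximable real numbers\<close>

text \<open>
  Approximations with an error bound \<open>C\<close> at scale \<open>2\<^sup>-\<^sup>w\<close>, instead of a fixed one, make the closure under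
  sums immediate. The difference of two naturals avoids coding integers.
\<close>

definition approximable :: "(baire \<Rightarrow> nat \<Rightarrow> real) \<Rightarrow> bool" where
  "approximable x \<longleftrightarrow> (\<exists>C f g. total_recursive f \<and> total_recursive g \<and>
     (\<forall>p n w. \<bar>2 ^ w * x p n - (real (f p \<langle>n, w\<rangle>) - real (g p \<langle>n, w\<rangle>))\<bar> \<le> real C))"

lemma approximableI:
  assumes "total_recursive f"
    and "\<And>p n w. \<bar>2 ^ w * x p n - real (f p \<langle>n, w\<rangle>)\<bar> \<le> real C"
  shows "approximable x"
  unfolding approximable_def
  using assms by (intro exI[of _ C] exI[of _ f] exI[of _ "\<lambda>p n. 0"]) (simp add: computability)

lemma approximable_compose:
  assumes "approximable x" "total_recursive h"
  shows "approximable (\<lambda>p n. x p (h p n))"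
proof -
  obtain C f g where fg: "total_recursive f" "total_recursive g"
    and *: "\<And>p n w. \<bar>2 ^ w * x p n - (real (f p \<langle>n, w\<rangle>) - real (g p \<langle>n, w\<rangle>))\<bar> \<le> real C"
    using assms(1) unfolding approximable_def by blast
  have "total_recursive (\<lambda>p z. \<langle>h p (pfst z), psnd z\<rangle>)"
    by (intro computability total_recursive_compose[OF assms(2)])
  note fg[THEN total_recursive_compose, OF this]
  then show ?thesis
    unfolding approximable_def using *
    by (intro exI[of _ C] exI[of _ "\<lambda>p z. f p \<langle>h p (pfst z), psnd z\<rangle>"]
        exI[of _ "\<lambda>p z. g p \<langle>h p (pfst z), psnd z\<rangle>"]) simp
qed

lemma approximable_diff [computability]:
  assumes "approximable x" "approximable y"
  shows "approximable (\<lambda>p n. x p n - y p n)"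
proof -
  obtain C f g where fg: "total_recursive f" "total_recursive g"
    and *: "\<And>p n w. \<bar>2 ^ w * x p n - (real (f p \<langle>n, w\<rangle>) - real (g p \<langle>n, w\<rangle>))\<bar> \<le> real C"
    using assms(1) unfolding approximable_def by blast
  obtain C' f' g' where fg': "total_recursive f'" "total_recursive g'"
    and **: "\<And>p n w. \<bar>2 ^ w * y p n - (real (f' p \<langle>n, w\<rangle>) - real (g' p \<langle>n, w\<rangle>))\<bar> \<le> real C'"
    using assms(2) unfolding approximable_def by blast
  have "\<bar>2 ^ w * (x p n - y p n) - (real (f p \<langle>n, w\<rangle> + g' p \<langle>n, w\<rangle>)
      - real (g p \<langle>n, w\<rangle> + f' p \<langle>n, w\<rangle>))\<bar> \<le> real (C + C')" for p n w
    using *[of w p n] **[of w p n] by (simp add: algebra_simps)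
  moreover have "total_recursive (\<lambda>p n. f p n + g' p n)" "total_recursive (\<lambda>p n. g p n + f' p n)"
    by (intro computability fg fg')+
  ultimately show ?thesis unfolding approximable_def by blast
qed

lemma approximable_zero [computability]: "approximable (\<lambda>p n. 0)"
  by (rule approximableI[of "\<lambda>p n. 0" _ 0]) (auto intro!: computability)

lemma approximable_add [computability]:
  assumes "approximable x" "approximable y"
  shows "approximable (\<lambda>p n. x p n + y p n)"
  using approximable_diff[OF assms(1) approximable_diff[OF approximable_zero assms(2)]] by simp

lemma of_nat_div_bounds:
  "real (a div b) \<le> real a / real b" "real a / real b \<le> real (a div b) + 1"
  using real_of_int_div4[of "int a" "int b"] real_of_int_div3[of "int a" "int b"]
  by (simp_all flip: of_nat_div zdiv_int)

lemma approximable_power_half [computability]: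
  assumes "total_recursive l"
  shows "approximable (\<lambda>p n. (1/2) ^ l p n)"
proof (rule approximableI)
  show "total_recursive (\<lambda>p x. 2 ^ psnd x div 2 ^ l p (pfst x))"
    by (intro computability total_recursive_compose[OF assms])
  show "\<bar>2 ^ w * (1/2) ^ l p n - real (2 ^ psnd \<langle>n, w\<rangle> div 2 ^ l p (pfst \<langle>n, w\<rangle>))\<bar> \<le> real 1" for p n w
    using of_nat_div_bounds[of "2 ^ w" "2 ^ l p n"] by (simp add: power_divide abs_le_iff)
qed

text \<open>
  The absolute value of the integer with code \<open>m\<close>: even codes \<open>2 * k\<close> stand for \<open>k\<close> and odd
  codes \<open>2 * k + 1\<close> for \<open>- k - 1\<close>.
\<close>

definition code_abs :: "nat \<Rightarrow> nat" where
  "code_abs m = (m + 1) div 2"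

definition dyadic_abs :: "nat \<Rightarrow> nat \<Rightarrow> nat" where
  "dyadic_abs w k = (2 ^ w * code_abs (pfst k)) div code_abs (psnd k)"

lemma code_abs: "real (code_abs m) = \<bar>real_of_int (int_decode m)\<bar>"
  by (auto simp: code_abs_def int_decode_def sum_decode_def elim!: evenE oddE)

lemma int_decode_nonneg: "0 \<le> int_decode m \<longleftrightarrow> even m"
  by (auto simp: int_decode_def sum_decode_def)

lemma of_rat_nat_to_rat_surj:
  "real_of_rat (nat_to_rat_surj k)
    = real_of_int (int_decode (pfst k)) / real_of_int (int_decode (psnd k))"
  by (cases "int_decode (psnd k) = 0")
    (simp_all add: nat_to_rat_surj_def Let_def case_prod_unfold of_rat_rat rat_number_collapse)

lemma abs_nat_to_rat_surj:
  "\<bar>real_of_rat (nat_to_rat_surj k)\<bar> = real (code_abs (pfst k)) / real (code_abs (psnd k))"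
  unfolding of_rat_nat_to_rat_surj by (simp add: code_abs)

lemma dyadic_abs:
  "\<bar>2 ^ w * \<bar>real_of_rat (nat_to_rat_surj k)\<bar> - real (dyadic_abs w k)\<bar> \<le> 1"
proof (cases "code_abs (psnd k) = 0")
  case True
  then show ?thesis by (simp only: abs_nat_to_rat_surj, simp add: dyadic_abs_def)
next
  case False
  then show ?thesis
    using of_nat_div_bounds[of "2 ^ w * code_abs (pfst k)" "code_abs (psnd k)"]
    by (simp only: abs_nat_to_rat_surj, simp add: dyadic_abs_def abs_le_iff)
qed

lemma total_recursive_dyadic_abs [computability]:
  assumes "total_recursive f" "total_recursive g"
  shows "total_recursive (\<lambda>p n. dyadic_abs (f p n) (g p n))"
  unfolding dyadic_abs_def code_abs_def by (intro computability assms)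

lemma decidable_even [computability]:
  assumes "total_recursive f"
  shows "decidable (\<lambda>p n. even (f p n))"
proof -
  have *: "even m \<longleftrightarrow> 2 * (m div 2) = m" for m :: nat
    by presburger
  show ?thesis
    unfolding * by (intro computability assms)
qed

text \<open>
  Only the positive part of a radius matters for a ball, and the signs of numerator and denominator
  are visible in the parity of their codes.
\<close>

definition positive_rat :: "nat \<Rightarrow> real" where
  "positive_rat k = max 0 (real_of_rat (nat_to_rat_surj k))"

lemma approximable_positive_rat [computability]:
  assumes "total_recursive f"
  shows "approximable (\<lambda>p n. positive_rat (f p n))"
proof (rule approximableI)
  let ?sign = "\<lambda>k. even (pfst k) \<and> even (psnd k) \<or> \<not> even (pfst k) \<and> \<not> even (psnd k)"
  let ?g = "\<lambda>p x. if ?sign (f p (pfst x)) then dyadic_abs (psnd x) (f p (pfst x)) else 0"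
  show "total_recursive ?g"
    by (intro computability total_recursive_compose[OF assms])
  have sign: "positive_rat k = (if ?sign k then \<bar>real_of_rat (nat_to_rat_surj k)\<bar> else 0)" for k
  proof -
    have "\<bar>real_of_rat (nat_to_rat_surj k)\<bar>
        = \<bar>real_of_int (int_decode (pfst k)) / real_of_int (int_decode (psnd k))\<bar>"
      by (simp only: of_rat_nat_to_rat_surj)
    then show ?thesis
      unfolding positive_rat_def of_rat_nat_to_rat_surj
      using int_decode_nonneg[of "pfst k"] int_decode_nonneg[of "psnd k"]
      by (auto simp: max_def zero_le_divide_iff divide_le_0_iff)
  qed
  show "\<bar>2 ^ w * positive_rat (f p n) - real (?g p \<langle>n, w\<rangle>)\<bar> \<le> real 1" for p n w
    using dyadic_abs[of w "f p n"] by (simp add: sign)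
qed

text \<open>
  Once \<open>2\<^sup>w\<close> times the gap exceeds twice the error bound, the approximations themselves differ
  by more than the bound, which is decidable and conclusive.
\<close>

lemma semidecidable_less [computability]:
  assumes "approximable x" "approximable y"
  shows "semidecidable (\<lambda>p n. x p n < y p n)"
proof -
  obtain C f g where fg: "total_recursive f" "total_recursive g"
    and *: "\<And>p n w. \<bar>2 ^ w * (y p n - x p n) - (real (f p \<langle>n, w\<rangle>) - real (g p \<langle>n, w\<rangle>))\<bar> \<le> real C"
    using approximable_diff[OF assms(2,1)] unfolding approximable_def by blast
  have "decidable (\<lambda>p z. g p z + C < f p z)"
    by (intro computability fg)
  then show ?thesis
  proof (rule semidecidableI)
    fix p n
    show "x p n < y p n \<longleftrightarrow> (\<exists>w. g p \<langle>n, w\<rangle> + C < f p \<langle>n, w\<rangle>)"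
    proof
      assume "x p n < y p n"
      then obtain w where w: "2 * real C / (y p n - x p n) < 2 ^ w"
        using real_arch_pow[of 2] by force
      then have "2 * real C < 2 ^ w * (y p n - x p n)"
        using \<open>x p n < y p n\<close> by (simp add: pos_divide_less_eq)
      then have "real (g p \<langle>n, w\<rangle> + C) < real (f p \<langle>n, w\<rangle>)"
        using *[of w p n] by (simp add: abs_le_iff)
      then show "\<exists>w. g p \<langle>n, w\<rangle> + C < f p \<langle>n, w\<rangle>"
        unfolding of_nat_less_iff by blast
    next
      assume "\<exists>w. g p \<langle>n, w\<rangle> + C < f p \<langle>n, w\<rangle>"
      then obtain w where "real (g p \<langle>n, w\<rangle> + C) < real (f p \<langle>n, w\<rangle>)"
        unfolding of_nat_less_iff by blast
      then have "0 < 2 ^ w * (y p n - x p n)"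
        using *[of w p n] by (simp add: abs_le_iff)
      then show "x p n < y p n" by (simp add: zero_less_mult_iff)
    qed
  qed
qed

lemma real_rep_distance:
  assumes "real_rep q = Some y"
  shows "\<bar>real_of_rat (nat_to_rat_surj (q w)) - y\<bar> \<le> (1/2) ^ w"
proof -
  let ?r = "\<lambda>n. real_of_rat (nat_to_rat_surj (q n))"
  let ?name = "cauchy_name UNIV dist (\<lambda>n. real_of_rat (nat_to_rat_surj n)) q"
  have lim: "?r \<longlonglongrightarrow> z" if "?name z" for z
    using that by (auto simp: cauchy_name_def intro: tendsto_dist_iff[THEN iffD2])
  have "\<exists>z. ?name z" "y = (THE z. ?name z)"
    using assms by (auto simp: real_rep_def cauchy_rep_def split: if_splits)
  moreover have "\<exists>\<^sub>\<le>\<^sub>1 z. ?name z"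
    using lim LIMSEQ_unique by (blast intro: Uniq_I)
  ultimately have y: "?name y"
    by (metis the1_equality' theI)
  then have "dist (?r n) (?r w) \<le> (1/2) ^ w" if "n \<ge> w" for n
    using that by (auto simp: cauchy_name_def intro: less_imp_le)
  moreover have "(\<lambda>n. dist (?r n) (?r w)) \<longlonglongrightarrow> dist y (?r w)"
    by (intro tendsto_intros lim y)
  ultimately have "dist y (?r w) \<le> (1/2) ^ w"
    by (intro tendsto_upperbound[of _ _ sequentially]) (auto intro: eventually_sequentiallyI[of w])
  then show ?thesis by (simp add: dist_real_def abs_minus_commute)
qed

text \<open>
  A realizer of \<open>D\<close> expects a name of the pair \<open>(i, j)\<close> as its oracle. Such a name is
  computable from \<open>\<langle>i, j\<rangle>\<close>, so it can be substituted for the oracle, and the resulting rationals \<open>q\<close>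
  become one recursive function of \<open>i\<close>, \<open>j\<close> and the precision.
\<close>

lemma approximable_distance:
  assumes "computable_map (prod_rep nat_rep nat_rep) real_rep (\<lambda>(i, j). D i j)"
    and nonneg: "\<And>i j. D i j \<ge> 0"
    and f: "total_recursive f" and g: "total_recursive g"
  shows "approximable (\<lambda>p n. D (f p n) (g p n))"
proof -
  obtain F M where F: "F \<turnstile>\<^sub>r \<lparr>in_rep = prod_rep nat_rep nat_rep, out_rep = real_rep,
      pdom = UNIV, vals = (\<lambda>x. {case x of (i, j) \<Rightarrow> D i j})\<rparr>"
    and M: "recursive_functional M" and MF: "\<And>p q. F p = Some q \<Longrightarrow> \<forall>n. M p n = Some (q n)"
    using assms(1) unfolding computable_map_def computable_baire_def by blast
  have real: "\<exists>q. (\<forall>n. M p n = Some (q n)) \<and> real_rep q = Some (D i j)"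
    if "prod_rep nat_rep nat_rep p = Some (i, j)" for p i j
  proof -
    have "\<exists>q y. F p = Some q \<and> real_rep q = Some y \<and> y \<in> {D i j}"
      using F that unfolding realizes_def by fastforce
    then show ?thesis using MF by blast
  qed
  let ?name = "\<lambda>p x. if psnd x = 0 then pfst (pfst x) else psnd (pfst x)"
  have "total_recursive ?name" by (intro computability)
  then have "recursive_functional (\<lambda>p x. Some (?name p x))" by (simp add: total_recursive_def)
  from recursive_functional_oracle_substitution[OF M this]
  obtain N where N: "recursive_functional N"
    and N_M: "\<And>p a q x. \<forall>n. Some (?name p \<langle>a, n\<rangle>) = Some (q n) \<Longrightarrow> N p \<langle>a, x\<rangle> = M q x"
    by blast
  have NM: "N p \<langle>a, x\<rangle> = M (\<lambda>n. ?name p \<langle>a, n\<rangle>) x" for p a x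
    by (rule N_M) simp
  have ex: "\<exists>q. (\<forall>n. N p \<langle>a, n\<rangle> = Some (q n)) \<and> real_rep q = Some (D (pfst a) (psnd a))" for p a
    using real[of "\<lambda>n. ?name p \<langle>a, n\<rangle>" "pfst a" "psnd a"]
    by (simp add: NM prod_rep_def nat_rep_def)
  define q where "q = (\<lambda>p x. the (N p x))"
  have N_q: "N p x = Some (q p x)" for p x
    using ex[of p "pfst x"] unfolding q_def by (metis option.sel pfst_psnd)
  have q: "total_recursive q"
    using N unfolding total_recursive_def by (simp add: N_q[symmetric])
  have D: "real_rep (\<lambda>n. q p \<langle>a, n\<rangle>) = Some (D (pfst a) (psnd a))" for p a
  proof -
    from ex obtain r where r: "\<forall>n. N p \<langle>a, n\<rangle> = Some (r n)" "real_rep r = Some (D (pfst a) (psnd a))"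
      by blast
    have "r = (\<lambda>n. q p \<langle>a, n\<rangle>)" using r(1) N_q by auto
    with r(2) show ?thesis by simp
  qed
  have "approximable (\<lambda>p a. D (pfst a) (psnd a))"
  proof (rule approximableI)
    show "total_recursive (\<lambda>p x. dyadic_abs (psnd x) (q p x))"
      by (intro computability q)
    fix p a w
    let ?r = "\<bar>real_of_rat (nat_to_rat_surj (q p \<langle>a, w\<rangle>))\<bar>"
    have "\<bar>?r - D (pfst a) (psnd a)\<bar> \<le> (1/2) ^ w"
      using real_rep_distance[OF D, of p a w] nonneg[of "pfst a" "psnd a"] by linarith
    then have "2 ^ w * \<bar>?r - D (pfst a) (psnd a)\<bar> \<le> 2 ^ w * (1/2) ^ w"
      by (intro mult_left_mono) auto
    then have "\<bar>2 ^ w * (?r - D (pfst a) (psnd a))\<bar> \<le> 1"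
      by (simp add: abs_mult power_divide)
    then show "\<bar>2 ^ w * D (pfst a) (psnd a) - real (dyadic_abs (psnd \<langle>a, w\<rangle>) (q p \<langle>a, w\<rangle>))\<bar> \<le> real 2"
      using dyadic_abs[of w "q p \<langle>a, w\<rangle>"] by (simp add: algebra_simps)
  qed
  from approximable_compose[OF this total_recursive_pair[OF f g]] show ?thesis by simp
qed

section \<open>Representations, limits and reductions\<close>

lemma computable_baire_total:
  "total_recursive f \<Longrightarrow> computable_baire (\<lambda>p. Some (f p))"
  unfolding computable_baire_def total_recursive_def by fastforce

lemma computable_baire_comp:
  assumes "computable_baire F" "computable_baire G"
  shows "computable_baire (F \<circ>\<^sub>m G)"
proof -
  obtain MF where MF: "recursive_functional MF" "\<And>p q. F p = Some q \<Longrightarrow> \<forall>n. MF p n = Some (q n)"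
    using assms(1) unfolding computable_baire_def by blast
  obtain MG where MG: "recursive_functional MG" "\<And>p q. G p = Some q \<Longrightarrow> \<forall>n. MG p n = Some (q n)"
    using assms(2) unfolding computable_baire_def by blast
  have "recursive_functional (\<lambda>p x. MG p (psnd x))"
    by (intro recursive_functional_compose[OF MG(1)] computability)
  from recursive_functional_oracle_substitution[OF MF(1) this]
  obtain N where N: "recursive_functional N"
    and NM: "\<And>p q x. \<forall>n. MG p n = Some (q n) \<Longrightarrow> N p \<langle>0, x\<rangle> = MF q x"
    by fastforce
  have "recursive_functional (\<lambda>p x. N p \<langle>0, x\<rangle>)"
    by (intro recursive_functional_compose[OF N] computability)
  moreover have "N p \<langle>0, n\<rangle> = Some (r n)" if r: "(F \<circ>\<^sub>m G) p = Some r" for p r n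
  proof -
    obtain q where "G p = Some q" "F q = Some r" using r by (auto simp: map_comp_Some_iff)
    then show ?thesis using NM MG(2) MF(2) by metis
  qed
  ultimately show ?thesis unfolding computable_baire_def by blast
qed

lemma sW_le_trans:
  assumes "f \<le>\<^sub>s\<^sub>W g" "g \<le>\<^sub>s\<^sub>W h"
  shows "f \<le>\<^sub>s\<^sub>W h"
proof -
  obtain K H where KH: "computable_baire K" "computable_baire H"
    "\<And>G. G \<turnstile>\<^sub>r g \<Longrightarrow> (H \<circ>\<^sub>m G \<circ>\<^sub>m K) \<turnstile>\<^sub>r f"
    using assms(1) unfolding sW_le_def by blast
  obtain K' H' where KH': "computable_baire K'" "computable_baire H'"
    "\<And>G. G \<turnstile>\<^sub>r h \<Longrightarrow> (H' \<circ>\<^sub>m G \<circ>\<^sub>m K') \<turnstile>\<^sub>r g"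
    using assms(2) unfolding sW_le_def by blast
  have "((H \<circ>\<^sub>m H') \<circ>\<^sub>m G \<circ>\<^sub>m (K' \<circ>\<^sub>m K)) \<turnstile>\<^sub>r f" if "G \<turnstile>\<^sub>r h" for G
  proof -
    have "(H \<circ>\<^sub>m H') \<circ>\<^sub>m G \<circ>\<^sub>m (K' \<circ>\<^sub>m K) = H \<circ>\<^sub>m (H' \<circ>\<^sub>m G \<circ>\<^sub>m K') \<circ>\<^sub>m K"
      by (auto simp: map_comp_def fun_eq_iff split: option.split)
    with KH(3)[OF KH'(3)[OF that]] show ?thesis by simp
  qed
  then show ?thesis
    unfolding sW_le_def
    by (intro exI[of _ "K' \<circ>\<^sub>m K"] exI[of _ "H \<circ>\<^sub>m H'"])
      (simp add: computable_baire_comp KH(1,2) KH'(1,2))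
qed

text \<open>
  When both translations are total, only names have to be compared and realizers disappear.
\<close>

lemma sW_leI:
  assumes "total_recursive K" "total_recursive H"
    and "\<And>p x. in_rep f p = Some x \<Longrightarrow> x \<in> pdom f \<Longrightarrow>
      \<exists>x'. in_rep g (K p) = Some x' \<and> x' \<in> pdom g \<and>
        (\<forall>q y. out_rep g q = Some y \<longrightarrow> y \<in> vals g x' \<longrightarrow>
          (\<exists>y'. out_rep f (H q) = Some y' \<and> y' \<in> vals f x))"
  shows "f \<le>\<^sub>s\<^sub>W g"
  unfolding sW_le_def
proof (intro exI conjI allI impI)
  show "computable_baire (\<lambda>p. Some (K p))" "computable_baire (\<lambda>p. Some (H p))"
    using assms(1,2) by (auto intro: computable_baire_total)
  fix G assume G: "G \<turnstile>\<^sub>r g"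
  show "((\<lambda>p. Some (H p)) \<circ>\<^sub>m G \<circ>\<^sub>m (\<lambda>p. Some (K p))) \<turnstile>\<^sub>r f"
    unfolding realizes_def
  proof (intro allI impI, elim conjE)
    fix p x assume px: "in_rep f p = Some x" "x \<in> pdom f"
    then obtain x' where x': "in_rep g (K p) = Some x'" "x' \<in> pdom g"
      "\<forall>q y. out_rep g q = Some y \<longrightarrow> y \<in> vals g x' \<longrightarrow>
          (\<exists>y'. out_rep f (H q) = Some y' \<and> y' \<in> vals f x)"
      using assms(3) by blast
    obtain q y where q: "G (K p) = Some q" "out_rep g q = Some y" "y \<in> vals g x'"
      using G x'(1,2) unfolding realizes_def by blast
    then show "\<exists>q y. ((\<lambda>p. Some (H p)) \<circ>\<^sub>m G \<circ>\<^sub>m (\<lambda>p. Some (K p))) p = Some q \<and>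
        out_rep f q = Some y \<and> y \<in> vals f x"
      using x'(3) by (simp add: map_comp_def)
  qed
qed

lemma seq_proj_tendsto_iff:
  "seq_proj p \<longlonglongrightarrow> q \<longleftrightarrow> (\<forall>n. \<exists>s0. \<forall>s\<ge>s0. p \<langle>s, n\<rangle> = q n)"
proof -
  have "seq_proj p \<longlonglongrightarrow> q \<longleftrightarrow> limitin (product_topology (\<lambda>_. euclidean) UNIV) (seq_proj p) q sequentially"
    by (simp add: euclidean_product_topology)
  also have "\<dots> \<longleftrightarrow> (\<forall>n. (\<lambda>s. p \<langle>s, n\<rangle>) \<longlonglongrightarrow> q n)"
    by (simp add: limitin_componentwise seq_proj_def)
  also have "\<dots> \<longleftrightarrow> (\<forall>n. \<exists>s0. \<forall>s\<ge>s0. p \<langle>s, n\<rangle> = q n)"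
    by (simp add: tendsto_discrete eventually_sequentially)
  finally show ?thesis .
qed

lemma lim_baire_eq_Some_iff:
  "lim_baire p = Some q \<longleftrightarrow> (\<forall>n. \<exists>s0. \<forall>s\<ge>s0. p \<langle>s, n\<rangle> = q n)"
proof -
  have "lim_baire p = Some q \<longleftrightarrow> seq_proj p \<longlonglongrightarrow> q"
  proof -
    have "(THE q. seq_proj p \<longlonglongrightarrow> q) = r" if "seq_proj p \<longlonglongrightarrow> r" for r
    proof (rule the_equality[where P = "\<lambda>q. seq_proj p \<longlonglongrightarrow> q", OF that])
      fix q assume "seq_proj p \<longlonglongrightarrow> q"
      then have "\<exists>s. p \<langle>s, n\<rangle> = q n \<and> p \<langle>s, n\<rangle> = r n" for n
        using that unfolding seq_proj_tendsto_iff by (meson nle_le)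
      then show "q = r" by (metis ext)
    qed
    then show ?thesis unfolding lim_baire_def by auto
  qed
  then show ?thesis by (simp only: seq_proj_tendsto_iff)
qed

lemma seq_rep_eq_Some_iff:
  "seq_rep \<delta> p = Some x \<longleftrightarrow> (\<forall>i. \<delta> (seq_proj p i) = Some (x i))"
proof
  show "\<forall>i. \<delta> (seq_proj p i) = Some (x i)" if "seq_rep \<delta> p = Some x"
    using that by (auto simp: seq_rep_def dom_def split: if_splits)
  show "seq_rep \<delta> p = Some x" if "\<forall>i. \<delta> (seq_proj p i) = Some (x i)"
    using that by (simp add: seq_rep_def dom_def)
qed

section \<open>Pi-2 predicates as sets of cluster points\<close>

text \<open>
  The number \<open>2 * e\<close> is output once for every \<open>c\<close> such that witnesses have been found for all
  \<open>c' \<le> c\<close>; hence infinitely often iff there are witnesses for all \<open>c\<close>. All other positions hold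
  pairwise distinct odd numbers, which are no cluster points.
\<close>

lemma cluster_points_of_Pi2:
  assumes R: "decidable R"
  obtains K where "total_recursive K"
    and "\<And>p m. infinite {n. K p n = m} \<longleftrightarrow> even m \<and> (\<forall>c. \<exists>w. R p \<langle>m div 2, \<langle>c, w\<rangle>\<rangle>)"
proof -
  \<comment> \<open>The number \<open>2 * e\<close> is output for \<open>c\<close> only at the least bound \<open>Suc w\<close> for the witnesses, so at most once.\<close>
  define below where "below = (\<lambda>p e c w. \<forall>c'<Suc c. \<exists>w'<w. R p \<langle>e, \<langle>c', w'\<rangle>\<rangle>)"
  define fires where "fires = (\<lambda>p e c w. below p e c (Suc w) \<and> \<not> below p e c w)"
  define K where "K = (\<lambda>p n. if fires p (pfst n) (pfst (psnd n)) (psnd (psnd n))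
      then 2 * pfst n else Suc (2 * n))"
  have "total_recursive K"
    unfolding K_def fires_def below_def
    by (intro total_recursive_if decidable_conj decidable_not decidable_bounded_ex
        decidable_bounded_all decidable_compose[OF R] computability)
  moreover have "infinite {n. K p n = m} \<longleftrightarrow> even m \<and> (\<forall>c. \<exists>w. R p \<langle>m div 2, \<langle>c, w\<rangle>\<rangle>)" for p m
  proof (cases "even m")
    case False
    then have "{n. K p n = m} \<subseteq> {m div 2}"
      by (auto simp: K_def split: if_splits)
    then show ?thesis
      using False finite_subset by auto
  next
    case True
    then obtain e where m: "m = 2 * e" by (elim evenE)
    let ?S = "{n. K p n = m}" and ?stage = "\<lambda>n. pfst (psnd n)"
    have S: "n \<in> ?S \<longleftrightarrow> pfst n = e \<and> fires p e (?stage n) (psnd (psnd n))" for n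
    proof -
      have "Suc (2 * n) \<noteq> 2 * e" by presburger
      then show ?thesis by (auto simp: K_def m)
    qed
    have uniq: "\<not> w < w'" if "fires p e c w" "fires p e c w'" for c w w'
    proof
      assume "w < w'"
      then have "below p e c w'" 
        using that(1) unfolding fires_def below_def by (meson Suc_leI order_less_le_trans)
      then show False using that(2) by (simp add: fires_def)
    qed
    show ?thesis
    proof (cases "\<forall>c. \<exists>w. R p \<langle>e, \<langle>c, w\<rangle>\<rangle>")
      case True
      have "c \<in> ?stage ` ?S" for c
      proof -
        have "\<exists>b. \<forall>c'<k. \<exists>w'<b. R p \<langle>e, \<langle>c', w'\<rangle>\<rangle>" for k
        proof (induction k)
          case (Suc k)
          then obtain b where b: "\<forall>c'<k. \<exists>w'<b. R p \<langle>e, \<langle>c', w'\<rangle>\<rangle>" by blast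
          obtain w where w: "R p \<langle>e, \<langle>k, w\<rangle>\<rangle>" using True by blast
          have "\<forall>c'<Suc k. \<exists>w'<max b (Suc w). R p \<langle>e, \<langle>c', w'\<rangle>\<rangle>"
            using b w by (metis less_SucE less_max_iff_disj lessI)
          then show ?case by blast
        qed auto
        then have ex: "\<exists>b. below p e c b" by (simp add: below_def)
        define b where "b = (LEAST b. below p e c b)"
        have b: "below p e c b" "\<And>b'. b' < b \<Longrightarrow> \<not> below p e c b'"
          unfolding b_def using LeastI_ex[OF ex] not_less_Least by blast+
        have "\<not> below p e c 0" by (auto simp: below_def)
        then obtain w where "b = Suc w" using b(1) by (cases b) auto
        then have "fires p e c w" using b by (simp add: fires_def)
        then have "\<langle>e, \<langle>c, w\<rangle>\<rangle> \<in> ?S" by (subst S) simp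
        then show ?thesis by (force intro: image_eqI[of _ _ "\<langle>e, \<langle>c, w\<rangle>\<rangle>"])
      qed
      then have "?stage ` ?S = UNIV" by auto
      then have "infinite ?S" by (metis finite_imageI infinite_UNIV_nat)
      with True show ?thesis by (simp add: m)
    next
      case False
      then obtain c where c: "\<And>w. \<not> R p \<langle>e, \<langle>c, w\<rangle>\<rangle>" by blast
      have "?stage n < c" if "n \<in> ?S" for n
      proof (rule ccontr)
        assume "\<not> ?stage n < c"
        then have "\<exists>w. R p \<langle>e, \<langle>c, w\<rangle>\<rangle>"
          using that[unfolded S] unfolding fires_def below_def by (auto simp: not_less less_Suc_eq_le)
        then show False using c by blast
      qed
      then have "?stage ` ?S \<subseteq> {..<c}" by auto
      moreover have "inj_on ?stage ?S"
      proof (rule inj_onI)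
        fix n n' assume n: "n \<in> ?S" and n': "n' \<in> ?S" and eq: "?stage n = ?stage n'"
        have "psnd (psnd n) = psnd (psnd n')"
          using n n' eq uniq unfolding S by (metis linorder_neqE_nat)
        then have "psnd n = psnd n'" using eq by (metis pfst_psnd)
        then show "n = n'" using n n' unfolding S by (metis pfst_psnd)
      qed
      ultimately have "finite ?S"
        using finite_imageD finite_lessThan finite_subset by blast
      with False show ?thesis by (simp add: m)
    qed
  qed
  ultimately show thesis by (rule that)
qed

section \<open>Computable metric spaces and their hyperspaces\<close>

locale computable_metric = Metric_space X d for X :: "'a set" and d +
  fixes \<alpha> :: "nat \<Rightarrow> 'a"
  assumes dense_in_X: "\<alpha> n \<in> X"
    and dense: "mtopology closure_of range \<alpha> = X"
    and computable_d: "computable_map (prod_rep nat_rep nat_rep) real_rep (\<lambda>(i, j). d (\<alpha> i) (\<alpha> j))"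
begin

lemma approximable_d [computability]:
  assumes "total_recursive f" "total_recursive g"
  shows "approximable (\<lambda>p n. d (\<alpha> (f p n)) (\<alpha> (g p n)))"
  using approximable_distance[OF computable_d _ assms] by simp

lemma dense_openE:
  assumes "openin mtopology U" "U \<noteq> {}"
  obtains z where "\<alpha> z \<in> U"
proof -
  obtain y where "y \<in> U" using assms(2) by blast
  moreover have "y \<in> mtopology closure_of range \<alpha>"
    using openin_subset[OF assms(1)] \<open>y \<in> U\<close> dense by auto
  ultimately show thesis using assms(1) that unfolding in_closure_of by blast
qed

lemma dense_approximates:
  assumes "y \<in> X" "\<epsilon> > 0"
  obtains z where "d y (\<alpha> z) < \<epsilon>"
  using dense_openE[OF openin_mball, of y \<epsilon>] assms by auto

lemma mem_rational_ball:
  "y \<in> rational_ball X d \<alpha> m \<longleftrightarrow> y \<in> X \<and> d (\<alpha> (pfst m)) y < positive_rat (psnd m)"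
proof -
  have "\<not> d (\<alpha> (pfst m)) y < 0" by (simp add: not_less)
  then show ?thesis
    using dense_in_X
    by (auto simp: rational_ball_def case_prod_unfold positive_rat_def less_max_iff_disj)
qed

lemma rational_ball_open: "openin mtopology (rational_ball X d \<alpha> m)"
  by (simp add: rational_ball_def case_prod_unfold)

lemma rational_ball_nhds:
  assumes "openin mtopology U" "y \<in> U"
  obtains m where "y \<in> rational_ball X d \<alpha> m" "rational_ball X d \<alpha> m \<subseteq> U"
proof -
  obtain r where r: "r > 0" "mball y r \<subseteq> U"
    using assms unfolding openin_mtopology by blast
  have y: "y \<in> X" using assms openin_subset by fastforce
  obtain n where n: "d y (\<alpha> n) < r / 4" using dense_approximates[OF y, of "r / 4"] r(1) by auto
  obtain s where s: "s \<in> \<rat>" "r / 4 < s" "s < r / 2"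
    using Rats_dense_in_real[of "r / 4" "r / 2"] r(1) by auto
  then obtain k where "s = of_rat (nat_to_rat_surj k)"
    using surj_of_rat_nat_to_rat_surj by blast
  then have k: "positive_rat k = s"
    using r(1) s by (simp add: positive_rat_def)
  have "y \<in> rational_ball X d \<alpha> \<langle>n, k\<rangle>"
    using n s y by (simp add: mem_rational_ball k commute)
  moreover have "rational_ball X d \<alpha> \<langle>n, k\<rangle> \<subseteq> mball y r"
    using n s y dense_in_X triangle[of y "\<alpha> n"] by (force simp: mem_rational_ball k)
  ultimately show thesis using that r(2) by blast
qed

text \<open>
  Serves as the entry of a list of balls that removes nothing.
\<close>

definition empty_ball :: nat where
  "empty_ball = \<langle>0, SOME k. nat_to_rat_surj k = 0\<rangle>"

lemma empty_ball: "rational_ball X d \<alpha> empty_ball = {}"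
proof -
  have "nat_to_rat_surj (SOME k. nat_to_rat_surj k = 0) = 0"
    using surj_nat_to_rat_surj by (metis (mono_tags, lifting) someI_ex surjD)
  then show ?thesis
    by (auto simp: mem_rational_ball empty_ball_def positive_rat_def not_less[THEN iffD2])
qed

lemma closure_of_eq_rational_balls:
  assumes "A \<subseteq> X"
  shows "mtopology closure_of A
    = X - (\<Union>m \<in> {m. rational_ball X d \<alpha> m \<inter> A = {}}. rational_ball X d \<alpha> m)"
proof (intro equalityI subsetI)
  fix y assume "y \<in> mtopology closure_of A"
  then show "y \<in> X - (\<Union>m \<in> {m. rational_ball X d \<alpha> m \<inter> A = {}}. rational_ball X d \<alpha> m)"
    using rational_ball_open by (fastforce simp: in_closure_of)
next
  fix y assume y: "y \<in> X - (\<Union>m \<in> {m. rational_ball X d \<alpha> m \<inter> A = {}}. rational_ball X d \<alpha> m)"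
  have "\<exists>a\<in>A. a \<in> U" if "openin mtopology U" "y \<in> U" for U
  proof -
    obtain m where "y \<in> rational_ball X d \<alpha> m" "rational_ball X d \<alpha> m \<subseteq> U"
      by (rule rational_ball_nhds[OF \<open>openin mtopology U\<close> \<open>y \<in> U\<close>])
    then show ?thesis using y by blast
  qed
  then show "y \<in> mtopology closure_of A" using y by (auto simp: in_closure_of)
qed

text \<open>
  The condition on the rate of convergence keeps all members of a name within distance less than \<open>1\<close>
  from the first one, so the first entry already reveals whether the name denotes \<open>\<infinity>\<close>, that is, \<open>None\<close>.
  Otherwise the indices are shifted by one.
\<close>

lemma cauchy_name_inf_cases:
  assumes "cauchy_name (add_inf X) (dist_inf d) (dense_inf \<alpha>) p x"
  shows "p 0 = 0 \<and> x = None \<or>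
    p 0 \<noteq> 0 \<and> (\<exists>y\<in>X. x = Some y \<and> (\<lambda>v. d (\<alpha> (p v - 1)) y) \<longlonglongrightarrow> 0 \<and>
      (\<forall>v. d (\<alpha> (p v - 1)) y \<le> (1/2) ^ v))"
proof -
  have x: "x \<in> add_inf X"
    and lim: "(\<lambda>n. dist_inf d (dense_inf \<alpha> (p n)) x) \<longlonglongrightarrow> 0"
    and rate: "\<And>k n. k \<le> n \<Longrightarrow> dist_inf d (dense_inf \<alpha> (p n)) (dense_inf \<alpha> (p k)) < (1/2) ^ k"
    using assms by (auto simp: cauchy_name_def)
  have const: "\<not> (\<lambda>n::nat. 1::real) \<longlonglongrightarrow> 0" by (simp add: LIMSEQ_const_iff)
  show ?thesis
  proof (cases "p 0")
    case 0
    have "p n = 0" for n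
      using rate[of 0 n] 0 by (cases "p n") (auto simp: dense_inf_def)
    then show ?thesis
      using lim const 0 by (cases x) (auto simp: dense_inf_def)
  next
    case (Suc a)
    have pos: "p n \<noteq> 0" for n
      using rate[of 0 n] Suc by (cases "p n") (auto simp: dense_inf_def)
    have alpha: "dense_inf \<alpha> (p n) = Some (\<alpha> (p n - 1))" for n
      using pos[of n] by (cases "p n") (simp_all add: dense_inf_def)
    obtain y where y: "x = Some y" "y \<in> X"
      using x lim const by (cases x) (auto simp: alpha add_inf_def)
    have lim_y: "(\<lambda>n. d (\<alpha> (p n - 1)) y) \<longlonglongrightarrow> 0"
      using lim by (simp add: alpha y)
    have "d (\<alpha> (p v - 1)) y \<le> (1/2) ^ v" for v
    proof (rule field_le_epsilon)
      fix e :: real assume "e > 0"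
      then have "\<forall>\<^sub>F n in sequentially. d (\<alpha> (p n - 1)) y < e"
        using lim_y by (rule order_tendstoD(2)[rotated])
      then obtain n where n: "n \<ge> v" "d (\<alpha> (p n - 1)) y < e"
        unfolding eventually_sequentially by (meson nle_le)
      have "d (\<alpha> (p n - 1)) (\<alpha> (p v - 1)) < (1/2) ^ v"
        using rate[OF n(1)] by (simp add: alpha)
      then show "d (\<alpha> (p v - 1)) y \<le> (1/2) ^ v + e"
        using triangle[of "\<alpha> (p v - 1)" "\<alpha> (p n - 1)" y] n(2) y dense_in_X commute
        by (smt (verit))
    qed
    then show ?thesis using Suc y lim_y by auto
  qed
qed

lemma cauchy_name_inf_unique:
  assumes "cauchy_name (add_inf X) (dist_inf d) (dense_inf \<alpha>) p x"
    and "cauchy_name (add_inf X) (dist_inf d) (dense_inf \<alpha>) p y"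
  shows "x = y"
proof -
  have "a = b" if "a \<in> X" "b \<in> X" "(\<lambda>v. d (\<alpha> (p v - 1)) a) \<longlonglongrightarrow> 0" "(\<lambda>v. d (\<alpha> (p v - 1)) b) \<longlonglongrightarrow> 0"
    for a b
  proof -
    have "limitin mtopology (\<lambda>v. \<alpha> (p v - 1)) a sequentially"
      "limitin mtopology (\<lambda>v. \<alpha> (p v - 1)) b sequentially"
      using that dense_in_X by (simp_all add: limitin_metric_dist_null)
    then show ?thesis using limitin_metric_unique trivial_limit_sequentially by blast
  qed
  then show ?thesis
    using cauchy_name_inf_cases[OF assms(1)] cauchy_name_inf_cases[OF assms(2)] by auto
qed

lemma cauchy_rep_inf_eq_Some_iff:
  "cauchy_rep_inf X d \<alpha> p = Some x \<longleftrightarrow> cauchy_name (add_inf X) (dist_inf d) (dense_inf \<alpha>) p x"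
proof -
  let ?name = "cauchy_name (add_inf X) (dist_inf d) (dense_inf \<alpha>) p"
  have "(THE z. ?name z) = y" if "?name y" for y
    using that by (rule the_equality[where P = ?name]) (rule cauchy_name_inf_unique[OF _ that])
  then show ?thesis unfolding cauchy_rep_inf_def cauchy_rep_def by auto
qed

lemma cauchy_rep_inf_const: "cauchy_rep_inf X d \<alpha> (\<lambda>_. c) = Some (dense_inf \<alpha> c)"
  unfolding cauchy_rep_inf_eq_Some_iff
  using dense_in_X by (cases c) (auto simp: cauchy_name_def dense_inf_def add_inf_def)

text \<open>
  The right-hand side refers to finite parts of the name only, and so makes membership of a named
  point in a rational ball semidecidable.
\<close>

lemma cauchy_rep_inf_ball:
  assumes "cauchy_rep_inf X d \<alpha> p = Some x"
  shows "(\<exists>y. x = Some y \<and> y \<in> rational_ball X d \<alpha> m) \<longleftrightarrow>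
    p 0 \<noteq> 0 \<and> (\<exists>v. d (\<alpha> (p v - 1)) (\<alpha> (pfst m)) + (1/2) ^ v < positive_rat (psnd m))"
  using cauchy_name_inf_cases[OF assms[unfolded cauchy_rep_inf_eq_Some_iff]]
proof (elim disjE conjE bexE)
  fix y assume p: "p 0 \<noteq> 0" and y: "y \<in> X" "x = Some y" and lim: "(\<lambda>v. d (\<alpha> (p v - 1)) y) \<longlonglongrightarrow> 0"
    and rate: "\<forall>v. d (\<alpha> (p v - 1)) y \<le> (1/2) ^ v"
  let ?c = "\<alpha> (pfst m)" and ?r = "positive_rat (psnd m)"
  have "d ?c y < ?r \<longleftrightarrow> (\<exists>v. d (\<alpha> (p v - 1)) ?c + (1/2) ^ v < ?r)"
  proof
    assume "d ?c y < ?r"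
    then obtain v where v: "(1/2) ^ v < (?r - d ?c y) / 2"
      using real_arch_pow_inv[of "(?r - d ?c y) / 2" "1/2"] by auto
    have "d (\<alpha> (p v - 1)) ?c \<le> (1/2) ^ v + d ?c y"
      using triangle[of "\<alpha> (p v - 1)" y ?c] rate y dense_in_X commute by (smt (verit))
    then show "\<exists>v. d (\<alpha> (p v - 1)) ?c + (1/2) ^ v < ?r"
      using v by (intro exI[of _ v]) simp
  next
    assume "\<exists>v. d (\<alpha> (p v - 1)) ?c + (1/2) ^ v < ?r"
    then obtain v where v: "d (\<alpha> (p v - 1)) ?c + (1/2) ^ v < ?r" ..
    have "d ?c y \<le> d (\<alpha> (p v - 1)) ?c + d (\<alpha> (p v - 1)) y"
      using triangle[of ?c "\<alpha> (p v - 1)" y] y dense_in_X commute by (smt (verit))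
    then show "d ?c y < ?r" using v rate by (smt (verit))
  qed
  then show ?thesis using p y by (simp add: mem_rational_ball)
qed auto

text \<open>
  The points of the dense sequence have constant names, so closures of enumerated sets of such points
  can be named directly: entry \<open>Suc z\<close> contributes \<open>\<alpha> z\<close>, entry \<open>0\<close> contributes \<open>\<infinity>\<close>, that is, nothing.
\<close>

lemma psi_plus_constant_names:
  assumes "\<And>i t v. q \<langle>i, \<langle>t, v\<rangle>\<rangle> = c i t"
  shows "seq_rep (psi_plus X d \<alpha>) q = Some (\<lambda>i. mtopology closure_of (\<alpha> ` {z. \<exists>t. c i t = Suc z}))"
proof -
  have "seq_proj (seq_proj q i) t = (\<lambda>_. c i t)" for i t
    by (simp add: seq_proj_def assms)
  then have names: "seq_rep (cauchy_rep_inf X d \<alpha>) (seq_proj q i) = Some (\<lambda>t. dense_inf \<alpha> (c i t))" for i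
    by (simp add: seq_rep_eq_Some_iff cauchy_rep_inf_const)
  have "Some a = dense_inf \<alpha> n \<longleftrightarrow> (\<exists>z. n = Suc z \<and> a = \<alpha> z)" for a n
    by (cases n) (auto simp: dense_inf_def)
  then have points: "{a. Some a \<in> range (\<lambda>t. dense_inf \<alpha> (c i t))} = \<alpha> ` {z. \<exists>t. c i t = Suc z}" for i
    unfolding image_iff by blast
  show ?thesis
    by (subst seq_rep_eq_Some_iff) (simp add: psi_plus_def names points)
qed

lemma psi_plusE:
  assumes "seq_rep (psi_plus X d \<alpha>) p = Some A"
  obtains x where "\<And>i k. cauchy_rep_inf X d \<alpha> (seq_proj (seq_proj p i) k) = Some (x i k)"
    and "\<And>i. A i = mtopology closure_of {a. Some a \<in> range (x i)}"
proof -
  have "\<forall>i. \<exists>x. seq_rep (cauchy_rep_inf X d \<alpha>) (seq_proj p i) = Some x \<and>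
      A i = mtopology closure_of {a. Some a \<in> range x}"
    using assms unfolding seq_rep_eq_Some_iff[of "psi_plus X d \<alpha>"] psi_plus_def
      map_option_eq_Some by metis
  then obtain x where "\<forall>i. seq_rep (cauchy_rep_inf X d \<alpha>) (seq_proj p i) = Some (x i) \<and>
      A i = mtopology closure_of {a. Some a \<in> range (x i)}"
    by metis
  then show thesis by (intro that[of x]) (auto simp: seq_rep_eq_Some_iff)
qed

lemma psi_minus_seq: "seq_rep (psi_minus X d \<alpha>) q = Some A \<longleftrightarrow>
    A = (\<lambda>i. X - (\<Union>j. rational_ball X d \<alpha> (q \<langle>i, j\<rangle>)))"
  by (auto simp: seq_rep_eq_Some_iff psi_minus_def seq_proj_def)

lemma limit_psi_minus:
  "(seq_rep (psi_minus X d \<alpha>) \<circ>\<^sub>m lim_baire) p = Some A \<longleftrightarrow>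
    (\<exists>q. lim_baire p = Some q \<and> A = (\<lambda>i. X - (\<Union>j. rational_ball X d \<alpha> (q \<langle>i, j\<rangle>))))"
  unfolding map_comp_def psi_minus_seq[symmetric] by (auto split: option.splits)

section \<open>Positive information gives negative information in the limit\<close>

text \<open>
  Stage \<open>s\<close> lists ball number \<open>m\<close> at position \<open>m\<close> unless within \<open>s\<close> steps one of the enumerated
  points was found in it. Each entry changes at most once, and the balls that survive are those disjoint
  from the enumerated points, whose union is the complement of their closure.
\<close>

lemma psi_plus_to_limit_psi_minus:
  "\<exists>K. total_recursive K \<and> (\<forall>p A. seq_rep (psi_plus X d \<alpha>) p = Some A \<longrightarrow>
      (seq_rep (psi_minus X d \<alpha>) \<circ>\<^sub>m lim_baire) (K p) = Some A)"
proof -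
  define hits where "hits = (\<lambda>p e. \<exists>k. p \<langle>pfst e, \<langle>k, 0\<rangle>\<rangle> \<noteq> 0 \<and>
    (\<exists>v. d (\<alpha> (p \<langle>pfst e, \<langle>k, v\<rangle>\<rangle> - 1)) (\<alpha> (pfst (psnd e))) + (1/2) ^ v
      < positive_rat (psnd (psnd e))))"
  have "semidecidable hits"
    unfolding hits_def by (intro computability | rule semidecidable_decidable)+
  then obtain D where D: "decidable D" "\<And>p e. hits p e \<longleftrightarrow> (\<exists>w. D p \<langle>e, w\<rangle>)"
    unfolding semidecidable_def by blast
  define K where "K = (\<lambda>p x. if \<exists>w<Suc (pfst x). D p \<langle>psnd x, w\<rangle> then empty_ball else psnd (psnd x))"
  define Q where "Q = (\<lambda>p e. if hits p e then empty_ball else psnd e)"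
  have "total_recursive K"
    unfolding K_def
    by (intro total_recursive_if decidable_bounded_ex decidable_compose[OF D(1)] computability)
  moreover have "(seq_rep (psi_minus X d \<alpha>) \<circ>\<^sub>m lim_baire) (K p) = Some A"
    if pA: "seq_rep (psi_plus X d \<alpha>) p = Some A" for p A
  proof -
    obtain x where x: "\<And>i k. cauchy_rep_inf X d \<alpha> (seq_proj (seq_proj p i) k) = Some (x i k)"
      and A: "\<And>i. A i = mtopology closure_of {a. Some a \<in> range (x i)}"
      by (rule psi_plusE[OF pA]) blast
    have range: "Some a \<in> range (x i) \<longleftrightarrow> (\<exists>k. x i k = Some a)" for a i
      by (metis rangeE rangeI)
    have hits: "hits p \<langle>i, m\<rangle> \<longleftrightarrow> rational_ball X d \<alpha> m \<inter> {a. Some a \<in> range (x i)} \<noteq> {}" for i m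
    proof -
      have "hits p \<langle>i, m\<rangle> \<longleftrightarrow> (\<exists>k y. x i k = Some y \<and> y \<in> rational_ball X d \<alpha> m)"
        unfolding cauchy_rep_inf_ball[OF x] by (simp add: hits_def seq_proj_def)
      also have "\<dots> \<longleftrightarrow> rational_ball X d \<alpha> m \<inter> {a. Some a \<in> range (x i)} \<noteq> {}"
        unfolding range by blast
      finally show ?thesis .
    qed
    have "\<exists>s0. \<forall>s\<ge>s0. K p \<langle>s, e\<rangle> = Q p e" for e
    proof (cases "hits p e")
      case True
      then obtain w where "D p \<langle>e, w\<rangle>" using D(2) by blast
      then have "\<forall>s\<ge>w. K p \<langle>s, e\<rangle> = Q p e"
        using True by (auto simp: K_def Q_def less_Suc_eq_le)
      then show ?thesis ..
    next
      case False
      then show ?thesis using D(2) by (auto simp: K_def Q_def)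
    qed
    then have lim: "lim_baire (K p) = Some (Q p)"
      by (simp add: lim_baire_eq_Some_iff)
    have subset: "{a. Some a \<in> range (x i)} \<subseteq> X" for i
    proof
      fix a assume "a \<in> {a. Some a \<in> range (x i)}"
      then obtain k where k: "x i k = Some a" unfolding range by blast
      from x[of i k] show "a \<in> X"
        unfolding cauchy_rep_inf_eq_Some_iff k by (auto simp: cauchy_name_def add_inf_def)
    qed
    have "(\<Union>j. rational_ball X d \<alpha> (Q p \<langle>i, j\<rangle>))
        = (\<Union>m \<in> {m. rational_ball X d \<alpha> m \<inter> {a. Some a \<in> range (x i)} = {}}. rational_ball X d \<alpha> m)" for i
    proof -
      have "rational_ball X d \<alpha> (Q p \<langle>i, j\<rangle>) = (if rational_ball X d \<alpha> j \<inter> {a. Some a \<in> range (x i)} = {}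
          then rational_ball X d \<alpha> j else {})" for j
        using hits[of i j] by (simp add: Q_def empty_ball)
      then show ?thesis by auto
    qed
    then have "A = (\<lambda>i. X - (\<Union>j. rational_ball X d \<alpha> (Q p \<langle>i, j\<rangle>)))"
      using A closure_of_eq_rational_balls[OF subset] by (simp add: fun_eq_iff)
    then show ?thesis
      unfolding map_comp_def lim option.case psi_minus_seq .
  qed
  ultimately show ?thesis by blast
qed

lemma BCT2_le_jump_BCT0: "BCT2 X d \<alpha> \<le>\<^sub>s\<^sub>W jump (BCT0 X d \<alpha>)"
proof -
  obtain K where K: "total_recursive K"
    "\<And>p A. seq_rep (psi_plus X d \<alpha>) p = Some A \<Longrightarrow>
      (seq_rep (psi_minus X d \<alpha>) \<circ>\<^sub>m lim_baire) (K p) = Some A"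
    using psi_plus_to_limit_psi_minus by blast
  have "total_recursive (\<lambda>q n. q n)" by (intro computability)
  from sW_leI[OF K(1) this, of "BCT2 X d \<alpha>" "jump (BCT0 X d \<alpha>)"] K(2) show ?thesis
    by (simp add: BCT2_def BCT0_def jump_def)
qed

lemma BCT3_le_jump_BCT1: "BCT3 X d \<alpha> \<le>\<^sub>s\<^sub>W jump (BCT1 X d \<alpha>)"
proof -
  obtain K where K: "total_recursive K"
    "\<And>p A. seq_rep (psi_plus X d \<alpha>) p = Some A \<Longrightarrow>
      (seq_rep (psi_minus X d \<alpha>) \<circ>\<^sub>m lim_baire) (K p) = Some A"
    using psi_plus_to_limit_psi_minus by blast
  have "total_recursive (\<lambda>q n. q n)" by (intro computability)
  from sW_leI[OF K(1) this, of "BCT3 X d \<alpha>" "jump (BCT1 X d \<alpha>)"] K(2) show ?thesis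
    by (simp add: BCT3_def BCT1_def jump_def)
qed

section \<open>Locally finite covers and limits of negative information\<close>

text \<open>
  The cells of level \<open>l\<close> refine the cover by the balls of radius \<open>2\<^sup>-\<^sup>l\<close> around \<open>\<alpha> m\<close>: from ball number \<open>m\<close>
  the earlier balls are removed, after shrinking them by an amount that tends to \<open>0\<close> with
  growing \<open>m\<close>. Shrinking keeps the cells open and semidecidable; since it vanishes in the limit,
  the cover is locally finite.
\<close>

definition cell :: "nat \<Rightarrow> nat \<Rightarrow> 'a set" where
  "cell m l = {x \<in> X. d x (\<alpha> m) < (1/2) ^ l \<and> (\<forall>m'<m. (1/2) ^ l - (1/2) ^ (l + m) < d x (\<alpha> m'))}"

lemma cell_open: "openin mtopology (cell m l)"
proof -
  have far: "openin mtopology {x \<in> X. \<forall>m'<k. s < d x (\<alpha> m')}" for k s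
  proof (induction k)
    case (Suc k)
    have "{x \<in> X. \<forall>m'<Suc k. s < d x (\<alpha> m')} = {x \<in> X. \<forall>m'<k. s < d x (\<alpha> m')} - mcball (\<alpha> k) s"
      using dense_in_X by (auto simp: less_Suc_eq commute)
    then show ?case using Suc by (simp add: openin_diff)
  qed simp
  have "cell m l = mball (\<alpha> m) ((1/2) ^ l) \<inter> {x \<in> X. \<forall>m'<m. (1/2) ^ l - (1/2) ^ (l + m) < d x (\<alpha> m')}"
    using dense_in_X by (auto simp: cell_def commute)
  then show ?thesis using far by (simp add: openin_Int)
qed

text \<open>
  The least \<open>m\<close> whose ball contains \<open>y\<close> works: \<open>y\<close> is outside of all earlier balls, all the more of
  the shrunken ones.
\<close>

lemma cells_cover:
  assumes "y \<in> X"
  obtains m where "y \<in> cell m l"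
proof -
  let ?near = "\<lambda>m. d y (\<alpha> m) < (1/2) ^ l"
  have "\<exists>m. ?near m"
    using dense_approximates[OF assms, of "(1/2) ^ l"] by auto
  then have "?near (LEAST m. ?near m)" by (rule LeastI_ex)
  moreover have "(1/2) ^ l - (1/2) ^ k < d y (\<alpha> m')" if "m' < (LEAST m. ?near m)" for m' k
    using not_less_Least[OF that] by (smt (verit) zero_less_power half_gt_zero_iff)
  ultimately have "y \<in> cell (LEAST m. ?near m) l" using assms by (simp add: cell_def)
  then show thesis by (rule that)
qed

text \<open>
  If \<open>y\<close> lies in ball number \<open>m0\<close> of level \<open>l\<close>, then a neighbourhood of \<open>y\<close> lies in the shrunken
  versions of this ball used for all large \<open>m\<close>, and is therefore disjoint from those cells.
\<close>

lemma cells_locally_finite: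
  assumes "y \<in> X"
  shows "\<exists>\<eta>>0. \<exists>B. \<forall>l<k. \<forall>x m. d y x < \<eta> \<longrightarrow> x \<in> cell m l \<longrightarrow> m \<le> B"
proof (induction k)
  case 0
  show ?case by (intro exI[of _ 1]) simp
next
  case (Suc l)
  then obtain \<eta> B where IH: "\<eta> > 0" "\<forall>l'<l. \<forall>x m. d y x < \<eta> \<longrightarrow> x \<in> cell m l' \<longrightarrow> m \<le> B"
    by blast
  obtain m0 where m0: "d y (\<alpha> m0) < (1/2) ^ l"
    using dense_approximates[OF assms, of "(1/2) ^ l"] by auto
  define g where "g = ((1/2) ^ l - d y (\<alpha> m0)) / 2"
  have two_g: "2 * g = (1/2) ^ l - d y (\<alpha> m0)" by (simp add: g_def)
  have "g > 0" using m0 by (simp add: g_def)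
  then obtain N where N: "(1/2) ^ N < g"
    using real_arch_pow_inv[of g "1/2"] by auto
  have "m \<le> max m0 N" if x: "d y x < g" "x \<in> cell m l" for x m
  proof (rule ccontr)
    assume "\<not> m \<le> max m0 N"
    then have m: "m0 < m" "N \<le> l + m" by auto
    have "(1/2) ^ l - (1/2) ^ (l + m) < d x (\<alpha> m0)"
      using x(2) m(1) by (simp add: cell_def)
    moreover have "d x (\<alpha> m0) \<le> d y x + d y (\<alpha> m0)"
      using triangle[of x y "\<alpha> m0"] x(2) assms dense_in_X commute by (simp add: cell_def)
    moreover have "((1/2) ^ (l + m) :: real) \<le> (1/2) ^ N"
      using m(2) by (intro power_decreasing) auto
    ultimately show False using x(1) N two_g by linarith
  qed
  then have "\<forall>l'<Suc l. \<forall>x m. d y x < min \<eta> g \<longrightarrow> x \<in> cell m l' \<longrightarrow> m \<le> max B (max m0 N)"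
    using IH(2) by (auto simp: less_Suc_eq le_max_iff_disj)
  then show ?case using IH(1) \<open>g > 0\<close> by (metis min_less_iff_conj)
qed

text \<open>
  One of the entries \<open>j \<le> l\<close> of list number \<open>i\<close> decides the ball of radius \<open>2\<^sup>-\<^sup>l\<close> around \<open>\<alpha> m\<close> if it does
  not change after stage \<open>l\<close> and the ball it lists contains that ball by virtue of centres and radii. Using
  the level \<open>l\<close> also as the stage makes the negation semidecidable and lets every final entry
  be taken into account on all high levels.
\<close>

definition undecided :: "baire \<Rightarrow> nat \<Rightarrow> nat \<Rightarrow> nat \<Rightarrow> bool" where
  "undecided p i m l \<longleftrightarrow> (\<forall>j<Suc l. (\<exists>t. l \<le> t \<and> p \<langle>t, \<langle>i, j\<rangle>\<rangle> \<noteq> p \<langle>l, \<langle>i, j\<rangle>\<rangle>) \<or>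
    positive_rat (psnd (p \<langle>l, \<langle>i, j\<rangle>\<rangle>)) < d (\<alpha> (pfst (p \<langle>l, \<langle>i, j\<rangle>\<rangle>))) (\<alpha> m) + (1/2) ^ l)"

lemma undecided_near_complement:
  assumes lim: "lim_baire p = Some q"
    and x: "x \<in> X" "\<And>j. x \<notin> rational_ball X d \<alpha> (q \<langle>i, j\<rangle>)" "d x (\<alpha> m) < (1/2) ^ l"
  shows "undecided p i m l"
  unfolding undecided_def
proof (intro allI impI, rule ccontr)
  fix j let ?b = "p \<langle>l, \<langle>i, j\<rangle>\<rangle>"
  assume "\<not> ((\<exists>t. l \<le> t \<and> p \<langle>t, \<langle>i, j\<rangle>\<rangle> \<noteq> ?b) \<or>
    positive_rat (psnd ?b) < d (\<alpha> (pfst ?b)) (\<alpha> m) + (1/2) ^ l)"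
  then have stable: "\<And>t. l \<le> t \<Longrightarrow> p \<langle>t, \<langle>i, j\<rangle>\<rangle> = ?b"
    and le: "d (\<alpha> (pfst ?b)) (\<alpha> m) + (1/2) ^ l \<le> positive_rat (psnd ?b)"
    by (blast, simp only: de_Morgan_disj not_less)
  obtain s0 where "\<And>s. s0 \<le> s \<Longrightarrow> p \<langle>s, \<langle>i, j\<rangle>\<rangle> = q \<langle>i, j\<rangle>"
    using lim unfolding lim_baire_eq_Some_iff by blast
  then have "?b = q \<langle>i, j\<rangle>" using stable[of "max l s0"] by simp
  moreover have "d (\<alpha> (pfst ?b)) x < positive_rat (psnd ?b)"
    using le x triangle[of "\<alpha> (pfst ?b)" "\<alpha> m" x] dense_in_X commute by (smt (verit))
  ultimately show False using x(1) x(2)[of j] by (simp add: mem_rational_ball)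
qed

text \<open>
  For large \<open>l\<close> the entry \<open>j\<close> is among the first ones, has reached its limit, and exceeds by more than
  \<open>2\<^sup>-\<^sup>l\<close> the distance of its centre from all points near \<open>y\<close>.
\<close>

lemma decided_inside:
  assumes lim: "lim_baire p = Some q" and y: "y \<in> rational_ball X d \<alpha> (q \<langle>i, j\<rangle>)"
  shows "\<exists>\<epsilon>>0. \<exists>k. \<forall>l\<ge>k. \<forall>m. d y (\<alpha> m) < \<epsilon> \<longrightarrow> \<not> undecided p i m l"
proof -
  let ?b = "q \<langle>i, j\<rangle>"
  define \<epsilon> where "\<epsilon> = (positive_rat (psnd ?b) - d (\<alpha> (pfst ?b)) y) / 2"
  have two_\<epsilon>: "2 * \<epsilon> = positive_rat (psnd ?b) - d (\<alpha> (pfst ?b)) y"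
    by (simp add: \<epsilon>_def)
  have y_X: "y \<in> X" and "\<epsilon> > 0" using y by (auto simp: \<epsilon>_def mem_rational_ball)
  obtain s0 where s0: "\<And>s. s0 \<le> s \<Longrightarrow> p \<langle>s, \<langle>i, j\<rangle>\<rangle> = ?b"
    using lim unfolding lim_baire_eq_Some_iff by blast
  obtain N where N: "(1/2) ^ N < \<epsilon>"
    using real_arch_pow_inv[of \<epsilon> "1/2"] \<open>\<epsilon> > 0\<close> by auto
  have "\<not> undecided p i m l" if l: "max j (max s0 N) \<le> l" and m: "d y (\<alpha> m) < \<epsilon>" for l m
  proof -
    have "((1/2) ^ l :: real) \<le> (1/2) ^ N"
      using l by (intro power_decreasing) auto
    then have "d (\<alpha> (pfst ?b)) (\<alpha> m) + (1/2) ^ l \<le> positive_rat (psnd ?b)"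
      using N m triangle[OF dense_in_X y_X dense_in_X, of "pfst ?b" m] two_\<epsilon> by linarith
    moreover have "j < Suc l" "\<forall>t\<ge>l. p \<langle>t, \<langle>i, j\<rangle>\<rangle> = p \<langle>l, \<langle>i, j\<rangle>\<rangle>" "p \<langle>l, \<langle>i, j\<rangle>\<rangle> = ?b"
      using l s0 by auto
    ultimately show ?thesis unfolding undecided_def by (metis not_less)
  qed
  with \<open>\<epsilon> > 0\<close> show ?thesis by blast
qed

text \<open>
  A point \<open>y\<close> of the complement lies in a cell of every level, which is undecided, so that \<open>Z\<close>
  contains a point within \<open>2 * 2\<^sup>-\<^sup>l\<close> of \<open>y\<close>.
\<close>

lemma complement_subset_closure_of_undecided:
  assumes lim: "lim_baire p = Some q"
    and Z: "\<And>m l. Z m l \<subseteq> {z. \<alpha> z \<in> cell m l}"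
      "\<And>m l. cell m l \<noteq> {} \<Longrightarrow> undecided p i m l \<Longrightarrow> Z m l \<noteq> {}"
  shows "X - (\<Union>j. rational_ball X d \<alpha> (q \<langle>i, j\<rangle>)) \<subseteq> mtopology closure_of (\<alpha> ` (\<Union>m l. Z m l))"
proof
  fix y assume y: "y \<in> X - (\<Union>j. rational_ball X d \<alpha> (q \<langle>i, j\<rangle>))"
  have "\<exists>z\<in>(\<Union>m l. Z m l). d y (\<alpha> z) < r" if "r > 0" for r
  proof -
    obtain l where l: "(1/2) ^ l < r / 2"
      using real_arch_pow_inv[of "r / 2" "1/2"] \<open>r > 0\<close> by auto
    obtain m where m: "y \<in> cell m l" using cells_cover y by blast
    then have "undecided p i m l"
      using y by (intro undecided_near_complement[OF lim, of y]) (auto simp: cell_def)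
    with m obtain z where z: "z \<in> Z m l" using Z(2) by blast
    then have "d (\<alpha> z) (\<alpha> m) < (1/2) ^ l" "d y (\<alpha> m) < (1/2) ^ l"
      using Z(1) m by (auto simp: cell_def)
    then have "d y (\<alpha> z) < r"
      using l y triangle[of y "\<alpha> m" "\<alpha> z"] dense_in_X commute[of "\<alpha> z" "\<alpha> m"] by simp
    with z show ?thesis by blast
  qed
  then show "y \<in> mtopology closure_of (\<alpha> ` (\<Union>m l. Z m l))"
    using y dense_in_X unfolding metric_closure_of by fastforce
qed

end

section \<open>Nowhere dense sets and cluster points in perfect Polish spaces\<close>

locale perfect_computable_Polish = computable_metric +
  assumes complete: mcomplete
    and perfect: "x \<in> X \<Longrightarrow> \<not> openin mtopology {x}"
begin

text \<open>
  Removing the last point of a finite open set would exhibit this point as isolated.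
\<close>

lemma perfect_open_minus_finite:
  assumes "finite F" "openin mtopology U" "U \<noteq> {}"
  shows "openin mtopology (U - F) \<and> U - F \<noteq> {}"
  using assms(1)
proof induction
  case empty
  then show ?case using assms by simp
next
  case (insert a F)
  have minus: "U - insert a F = (U - F) - {a}" by auto
  have "openin mtopology ((U - F) - {a})"
  proof (cases "a \<in> X")
    case True
    then have "closedin mtopology {a}"
      by (intro closedin_Hausdorff_finite Hausdorff_space_mtopology) auto
    then show ?thesis using insert.IH by (simp add: openin_diff)
  next
    case False
    then have "(U - F) - {a} = U - F"
      using insert.IH openin_subset by fastforce
    then show ?thesis using insert.IH by simp
  qed
  moreover have "(U - F) - {a} \<noteq> {}"
  proof
    assume "(U - F) - {a} = {}"
    then have "U - F = {a}" using insert.IH by auto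
    then show False using insert.IH perfect[of a] openin_subset by force
  qed
  ultimately show ?case by (simp only: minus simp_thms)
qed

text \<open>
  An open set \<open>U\<close> in the closure would meet one of the removed balls. Near a point \<open>y\<close> of it, high levels
  are decided and contribute nothing, while the remaining levels \<open>l < k\<close> contribute only finitely many
  points by local finiteness. Without these finitely many points there remains a nonempty open set that
  avoids all enumerated ones.
\<close>

lemma undecided_nowhere_dense:
  assumes lim: "lim_baire p = Some q"
    and empty: "mtopology interior_of (X - (\<Union>j. rational_ball X d \<alpha> (q \<langle>i, j\<rangle>))) = {}"
    and Z: "\<And>m l. finite (Z m l)" "\<And>m l. Z m l \<subseteq> {z. \<alpha> z \<in> cell m l \<and> undecided p i m l}"
  shows "mtopology interior_of (mtopology closure_of (\<alpha> ` (\<Union>m l. Z m l))) = {}"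
proof -
  define S where "S = \<alpha> ` (\<Union>m l. Z m l)"
  define U where "U = mtopology interior_of (mtopology closure_of S)"
  have "U = {}"
  proof (rule ccontr)
    assume "U \<noteq> {}"
    then have U: "openin mtopology U" "U \<noteq> {}" by (simp_all add: U_def)
    then have "\<not> U \<subseteq> X - (\<Union>j. rational_ball X d \<alpha> (q \<langle>i, j\<rangle>))"
      using empty interior_of_maximal by (metis subset_empty)
    moreover have "U \<subseteq> X" using openin_subset[OF U(1)] by simp
    ultimately obtain y j where y: "y \<in> U" "y \<in> X" "y \<in> rational_ball X d \<alpha> (q \<langle>i, j\<rangle>)"
      by blast
    obtain \<epsilon> k0 where \<epsilon>: "\<epsilon> > 0" "\<And>l m. k0 \<le> l \<Longrightarrow> d y (\<alpha> m) < \<epsilon> \<Longrightarrow> \<not> undecided p i m l"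
      using decided_inside[OF lim y(3)] by blast
    obtain N where N: "(1/2) ^ N < \<epsilon> / 2"
      using real_arch_pow_inv[of "\<epsilon> / 2" "1/2"] \<epsilon>(1) by auto
    \<comment> \<open>From level \<open>k\<close> on, a ball whose cell contains a point within \<open>\<epsilon> / 2\<close> of \<open>y\<close>
      has its centre within \<open>\<epsilon>\<close> of \<open>y\<close> and is therefore decided.\<close>
    define k where "k = max k0 N"
    obtain \<eta> B where \<eta>: "\<eta> > 0" "\<And>l x m. l < k \<Longrightarrow> d y x < \<eta> \<Longrightarrow> x \<in> cell m l \<Longrightarrow> m \<le> B"
      using cells_locally_finite[OF y(2), of k] by blast
    define F where "F = \<alpha> ` (\<Union>l<k. \<Union>m\<le>B. Z m l)"
    define V where "V = U \<inter> mball y (min (\<epsilon> / 2) \<eta>)"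
    have "finite F" unfolding F_def using Z(1) by auto
    have V: "openin mtopology V" "V \<noteq> {}"
      using U(1) y \<epsilon>(1) \<eta>(1) by (auto simp: V_def intro: openin_Int)
    have "\<alpha> z \<in> F" if z: "z \<in> Z m l" "\<alpha> z \<in> V" for z m l
    proof -
      have cell: "\<alpha> z \<in> cell m l" and und: "undecided p i m l" using Z(2) z(1) by auto
      have near: "d y (\<alpha> z) < \<epsilon> / 2" "d y (\<alpha> z) < \<eta>" using z(2) by (auto simp: V_def)
      have "l < k"
      proof (rule ccontr)
        assume "\<not> l < k"
        then have "k0 \<le> l" "((1/2) ^ l :: real) \<le> (1/2) ^ N"
          by (auto simp: k_def intro: power_decreasing)
        moreover have "d (\<alpha> z) (\<alpha> m) < (1/2) ^ l" using cell by (simp add: cell_def)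
        ultimately have "d y (\<alpha> m) < \<epsilon>"
          using triangle[of y "\<alpha> z" "\<alpha> m"] near(1) N y(2) dense_in_X by (smt (verit) field_sum_of_halves)
        then show False using \<epsilon>(2) \<open>k0 \<le> l\<close> und by blast
      qed
      moreover have "m \<le> B" using \<eta>(2)[OF \<open>l < k\<close> near(2) cell] .
      ultimately show ?thesis using z(1) unfolding F_def by blast
    qed
    then have disjoint: "(V - F) \<inter> S = {}" unfolding S_def by blast
    obtain x where x: "x \<in> V - F" and VF: "openin mtopology (V - F)"
      using perfect_open_minus_finite[OF \<open>finite F\<close> V] by blast
    have "x \<in> mtopology closure_of S"
      using x interior_of_subset unfolding V_def U_def by fastforce
    then have "\<exists>a\<in>S. a \<in> V - F" using x VF unfolding in_closure_of by blast
    then show False using disjoint by blast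
  qed
  then show ?thesis by (simp only: U_def S_def)
qed

text \<open>
  For every undecided cell that contains a point of the dense sequence, the first such point found
  is enumerated. Choosing only one point per cell is what makes the closure nowhere dense. The
  new sets contain the given ones, so every solution of the new instance solves the given one.
\<close>

lemma jump_BCT0_le_BCT2: "jump (BCT0 X d \<alpha>) \<le>\<^sub>s\<^sub>W BCT2 X d \<alpha>"
proof -
  define W where "W = (\<lambda>p e z. d (\<alpha> z) (\<alpha> (pfst (psnd e))) < (1/2) ^ psnd (psnd e) \<and>
      (\<forall>m'<pfst (psnd e). (1/2) ^ psnd (psnd e) - (1/2) ^ (psnd (psnd e) + pfst (psnd e))
        < d (\<alpha> z) (\<alpha> m')) \<and>
      undecided p (pfst e) (pfst (psnd e)) (psnd (psnd e)))"
  have W: "W p \<langle>i, \<langle>m, l\<rangle>\<rangle> z \<longleftrightarrow> \<alpha> z \<in> cell m l \<and> undecided p i m l" for p i m l z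
    using dense_in_X by (simp add: W_def cell_def)
  have "semidecidable (\<lambda>p x. W p (pfst x) (psnd x))"
    unfolding W_def undecided_def by (intro computability | rule semidecidable_decidable)+
  then obtain h where h: "total_recursive h"
    and h_sound: "\<And>p e w z. h p \<langle>e, w\<rangle> = Suc z \<Longrightarrow> W p e z"
    and h_complete: "\<And>p e z. W p e z \<Longrightarrow> \<exists>w z'. h p \<langle>e, w\<rangle> = Suc z'"
    and h_unique: "\<And>p e v w. h p \<langle>e, v\<rangle> \<noteq> 0 \<Longrightarrow> h p \<langle>e, w\<rangle> \<noteq> 0 \<Longrightarrow> v = w"
    by (rule semidecidable_choice) blast
  define c where "c = (\<lambda>p i t. h p \<langle>\<langle>i, pfst t\<rangle>, psnd t\<rangle>)"
  define K where "K = (\<lambda>p n. c p (pfst n) (pfst (psnd n)))"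
  define Z where "Z = (\<lambda>p i m l. {z. \<exists>w. h p \<langle>\<langle>i, \<langle>m, l\<rangle>\<rangle>, w\<rangle> = Suc z})"
  have K: "total_recursive K"
    unfolding K_def c_def by (intro total_recursive_compose[OF h] computability)
  have id: "total_recursive (\<lambda>q n. q n)" by (intro computability)
  have indices: "{z. \<exists>t. c p i t = Suc z} = (\<Union>m l. Z p i m l)" for p i
  proof -
    have "(\<exists>t. c p i t = Suc z) \<longleftrightarrow> (\<exists>m l w. h p \<langle>\<langle>i, \<langle>m, l\<rangle>\<rangle>, w\<rangle> = Suc z)" for z
      unfolding c_def by (metis fst_conv snd_conv prod_encode_inverse pfst_psnd)
    then show ?thesis by (auto simp: Z_def)
  qed
  have Z_finite: "finite (Z p i m l)" for p i m l
  proof -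
    have "z = z'" if zz': "z \<in> Z p i m l" "z' \<in> Z p i m l" for z z'
    proof -
      obtain v w where vw: "h p \<langle>\<langle>i, \<langle>m, l\<rangle>\<rangle>, v\<rangle> = Suc z" "h p \<langle>\<langle>i, \<langle>m, l\<rangle>\<rangle>, w\<rangle> = Suc z'"
        using zz' unfolding Z_def by blast
      then have "v = w" using h_unique[of p "\<langle>i, \<langle>m, l\<rangle>\<rangle>" v w] by simp
      with vw show ?thesis by simp
    qed
    then have "Z p i m l \<subseteq> {z}" if "z \<in> Z p i m l" for z using that by blast
    then show ?thesis by (metis finite.emptyI finite.insertI finite_subset equals0I)
  qed
  have Z_sound: "Z p i m l \<subseteq> {z. \<alpha> z \<in> cell m l \<and> undecided p i m l}" for p i m l
    using h_sound unfolding Z_def W[symmetric] by blast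
  have Z_complete: "Z p i m l \<noteq> {}" if cell: "cell m l \<noteq> {}" and und: "undecided p i m l" for p i m l
  proof -
    obtain z where "\<alpha> z \<in> cell m l" by (rule dense_openE[OF cell_open cell])
    then have "W p \<langle>i, \<langle>m, l\<rangle>\<rangle> z" using und by (simp add: W)
    then show ?thesis using h_complete unfolding Z_def by blast
  qed
  show ?thesis
  proof (rule sW_leI[OF K id])
    fix p A assume "in_rep (jump (BCT0 X d \<alpha>)) p = Some A" and dom: "A \<in> pdom (jump (BCT0 X d \<alpha>))"
    then obtain q where lim: "lim_baire p = Some q"
      and A: "A = (\<lambda>i. X - (\<Union>j. rational_ball X d \<alpha> (q \<langle>i, j\<rangle>)))"
      using limit_psi_minus by (auto simp: jump_def BCT0_def)
    define A' where "A' = (\<lambda>i. mtopology closure_of (\<alpha> ` (\<Union>m l. Z p i m l)))"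
    have "in_rep (BCT2 X d \<alpha>) (K p) = Some A'"
      using psi_plus_constant_names[of "K p" "c p"] by (simp add: BCT2_def A'_def K_def indices)
    moreover have "mtopology interior_of (A' i) = {}" for i
      unfolding A'_def using dom
      by (intro undecided_nowhere_dense[OF lim _ Z_finite Z_sound])
        (simp add: A jump_def BCT0_def nowhere_dense_seqs_def)
    then have "A' \<in> pdom (BCT2 X d \<alpha>)"
      by (simp add: BCT2_def nowhere_dense_seqs_def) (simp add: A'_def)
    moreover have "A i \<subseteq> A' i" for i
      unfolding A A'_def
      by (rule complement_subset_closure_of_undecided[OF lim]) (use Z_sound Z_complete in blast)+
    then have "vals (BCT2 X d \<alpha>) A' \<subseteq> vals (jump (BCT0 X d \<alpha>)) A"
      by (auto simp: jump_def BCT0_def BCT2_def)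
    moreover have "out_rep (jump (BCT0 X d \<alpha>)) = out_rep (BCT2 X d \<alpha>)"
      by (simp add: jump_def BCT0_def BCT2_def)
    ultimately show "\<exists>x'. in_rep (BCT2 X d \<alpha>) (K p) = Some x' \<and> x' \<in> pdom (BCT2 X d \<alpha>) \<and>
        (\<forall>q y. out_rep (BCT2 X d \<alpha>) q = Some y \<longrightarrow> y \<in> vals (BCT2 X d \<alpha>) x' \<longrightarrow>
          (\<exists>y'. out_rep (jump (BCT0 X d \<alpha>)) q = Some y' \<and> y' \<in> vals (jump (BCT0 X d \<alpha>)) A))"
      by auto
  qed
qed

text \<open>
  Position \<open>\<langle>a, z\<rangle>\<close> of the name of \<open>A\<^sub>i\<close> contributes \<open>\<alpha> z\<close> if \<open>z \<le> a\<close> and the sequence takes the value \<open>i\<close>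
  at \<open>a\<close>. So \<open>A\<^sub>i\<close> is the whole space if the value occurs infinitely often and finite otherwise.
\<close>

lemma CL_le_BCT3: "CL_nat \<le>\<^sub>s\<^sub>W BCT3 X d \<alpha>"
proof -
  define c :: "baire \<Rightarrow> nat \<Rightarrow> nat \<Rightarrow> nat" where "c = (\<lambda>p i t. if p (pfst t) = i \<and> psnd t \<le> pfst t then Suc (psnd t) else 0)"
  define K where "K = (\<lambda>p n. c p (pfst n) (pfst (psnd n)))"
  define A where "A = (\<lambda>p i. mtopology closure_of (\<alpha> ` {z. \<exists>t. c p i t = Suc z}))"
  have K: "total_recursive K" unfolding K_def c_def by (intro computability)
  have id: "total_recursive (\<lambda>q n. q n)" by (intro computability)
  have indices: "{z. \<exists>t. c p i t = Suc z} = {z. \<exists>a. p a = i \<and> z \<le> a}" for p i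
    by (auto simp: c_def split: if_splits) (metis fst_conv snd_conv prod_encode_inverse)
  show ?thesis
  proof (rule sW_leI[OF K id])
    fix p x assume "in_rep CL_nat p = Some x" "x \<in> pdom CL_nat"
    then obtain k where [simp]: "x = p" and k: "infinite {n. p n = k}"
      by (auto simp: CL_nat_def)
    have name: "in_rep (BCT3 X d \<alpha>) (K p) = Some (A p)"
      using psi_plus_constant_names[of "K p" "c p"] by (simp add: BCT3_def A_def K_def)
    have "{z. \<exists>a. p a = k \<and> z \<le> a} = UNIV"
    proof -
      have "\<exists>a. p a = k \<and> z \<le> a" for z
        using k unfolding infinite_nat_iff_unbounded_le by blast
      then show ?thesis by blast
    qed
    then have "A p k = X" by (simp only: A_def indices dense)
    moreover have "A p i \<subseteq> X" for i
      unfolding A_def using closure_of_subset_topspace[of mtopology] by simp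
    ultimately have "X = (\<Union>i. A p i)" by blast
    then have dom: "A p \<in> pdom (BCT3 X d \<alpha>)"
      by (simp add: BCT3_def closed_cover_seqs_def) (simp add: A_def)
    have "infinite {n. p n = i}" if "mtopology interior_of (A p i) \<noteq> {}" for i
    proof
      assume fin: "finite {n. p n = i}"
      have "{z. \<exists>a. p a = i \<and> z \<le> a} = (\<Union>a\<in>{n. p n = i}. {..a})" by auto
      then have fin': "finite (\<alpha> ` {z. \<exists>t. c p i t = Suc z})"
        using fin by (simp only: indices) simp
      then have "closedin mtopology (\<alpha> ` {z. \<exists>t. c p i t = Suc z})"
        using dense_in_X by (intro closedin_Hausdorff_finite Hausdorff_space_mtopology) auto
      then have "A p i = \<alpha> ` {z. \<exists>t. c p i t = Suc z}"
        by (simp add: A_def closure_of_eq)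
      with fin' have "finite (A p i)" by simp
      then have "mtopology interior_of (A p i) - A p i \<noteq> {}"
        using perfect_open_minus_finite[OF _ openin_interior_of that] by blast
      then show False using interior_of_subset by fastforce
    qed
    with name dom show "\<exists>x'. in_rep (BCT3 X d \<alpha>) (K p) = Some x' \<and> x' \<in> pdom (BCT3 X d \<alpha>) \<and>
        (\<forall>q y. out_rep (BCT3 X d \<alpha>) q = Some y \<longrightarrow> y \<in> vals (BCT3 X d \<alpha>) x' \<longrightarrow>
          (\<exists>y'. out_rep CL_nat q = Some y' \<and> y' \<in> vals CL_nat x))"
      by (intro exI[of _ "A p"]) (auto simp: BCT3_def CL_nat_def)
  qed
qed

text \<open>
  The ball with centre \<open>\<alpha> n\<close> and radius \<open>2\<^sup>-\<^sup>k\<close> is contained in \<open>A\<^sub>i\<close> iff it meets none of the balls in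
  the limit of list \<open>i\<close>. That no search \<open>u\<close> for a common point succeeds is a decidable
  condition on the limit entry, and since the entries are eventually constant, it holds iff it holds for
  the entries at infinitely many stages \<open>s\<close>: a \<open>\<Pi>\<^sub>2\<close> condition on \<open>p\<close>. A cluster point \<open>2 * \<langle>i, \<langle>n, k\<rangle>\<rangle>\<close>
  is decoded to \<open>i\<close>.
\<close>

lemma jump_BCT1_le_CL: "jump (BCT1 X d \<alpha>) \<le>\<^sub>s\<^sub>W CL_nat"
proof -
  define meets where "meets = (\<lambda>p :: baire. \<lambda>e. \<exists>z.
      d (\<alpha> (pfst (pfst e))) (\<alpha> z) < (1/2) ^ psnd (pfst e) \<and>
      d (\<alpha> (pfst (psnd e))) (\<alpha> z) < positive_rat (psnd (psnd e)))"
  have meets: "meets p \<langle>\<langle>n, k\<rangle>, b\<rangle> \<longleftrightarrow> mball (\<alpha> n) ((1/2) ^ k) \<inter> rational_ball X d \<alpha> b \<noteq> {}" for p n k b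
  proof -
    have "meets p \<langle>\<langle>n, k\<rangle>, b\<rangle> \<longleftrightarrow> (\<exists>z. \<alpha> z \<in> mball (\<alpha> n) ((1/2) ^ k) \<inter> rational_ball X d \<alpha> b)"
      using dense_in_X by (simp add: meets_def mem_rational_ball)
    moreover have "openin mtopology (mball (\<alpha> n) ((1/2) ^ k) \<inter> rational_ball X d \<alpha> b)"
      by (intro openin_Int openin_mball rational_ball_open)
    ultimately show ?thesis using dense_openE by (metis empty_iff)
  qed
  have "semidecidable meets"
    unfolding meets_def by (intro computability)
  then obtain D where D: "decidable D" "\<And>p e. meets p e \<longleftrightarrow> (\<exists>u. D p \<langle>e, u\<rangle>)"
    unfolding semidecidable_def by blast
  \<comment> \<open>The universally quantified \<open>c\<close> codes a list position \<open>j\<close>, a search bound \<open>u\<close> and a stage \<open>s0\<close>; the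
    witness is a later stage \<open>s\<close>.\<close>
  define R where "R = (\<lambda>p x. psnd (pfst (psnd x)) \<le> psnd (psnd x) \<and>
      \<not> D p \<langle>\<langle>psnd (pfst x), p \<langle>psnd (psnd x), \<langle>pfst (pfst x), pfst (pfst (pfst (psnd x)))\<rangle>\<rangle>\<rangle>,
        psnd (pfst (pfst (psnd x)))\<rangle>)"
  have R: "R p \<langle>\<langle>i, e\<rangle>, \<langle>\<langle>\<langle>j, u\<rangle>, s0\<rangle>, s\<rangle>\<rangle> \<longleftrightarrow> s0 \<le> s \<and> \<not> D p \<langle>\<langle>e, p \<langle>s, \<langle>i, j\<rangle>\<rangle>\<rangle>, u\<rangle>" for p i e j u s0 s
    by (simp add: R_def)
  have "decidable R"
    unfolding R_def by (intro decidable_conj decidable_not decidable_compose[OF D(1)] computability)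
  then obtain K where K: "total_recursive K"
    and cluster: "\<And>p m. infinite {n. K p n = m} \<longleftrightarrow> even m \<and> (\<forall>c. \<exists>s. R p \<langle>m div 2, \<langle>c, s\<rangle>\<rangle>)"
    by (rule cluster_points_of_Pi2) blast
  have H: "total_recursive (\<lambda>q n. pfst (q 0 div 2))" by (intro computability)
  have good: "(\<forall>c. \<exists>s. R p \<langle>\<langle>i, e\<rangle>, \<langle>c, s\<rangle>\<rangle>) \<longleftrightarrow> (\<forall>j. \<not> meets p \<langle>e, q \<langle>i, j\<rangle>\<rangle>)"
    if lim: "lim_baire p = Some q" for p q i e
  proof -
    have "(\<forall>c. \<exists>s. R p \<langle>\<langle>i, e\<rangle>, \<langle>c, s\<rangle>\<rangle>) \<longleftrightarrow> (\<forall>j u s0. \<exists>s\<ge>s0. \<not> D p \<langle>\<langle>e, p \<langle>s, \<langle>i, j\<rangle>\<rangle>\<rangle>, u\<rangle>)"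
      unfolding R[symmetric] by (metis pfst_psnd)
    also have "\<dots> \<longleftrightarrow> (\<forall>j u. \<not> D p \<langle>\<langle>e, q \<langle>i, j\<rangle>\<rangle>, u\<rangle>)"
    proof -
      have "(\<forall>s0. \<exists>s\<ge>s0. \<not> D p \<langle>\<langle>e, p \<langle>s, \<langle>i, j\<rangle>\<rangle>\<rangle>, u\<rangle>) \<longleftrightarrow> \<not> D p \<langle>\<langle>e, q \<langle>i, j\<rangle>\<rangle>, u\<rangle>" for j u
      proof -
        obtain s1 where s1: "\<And>s. s1 \<le> s \<Longrightarrow> p \<langle>s, \<langle>i, j\<rangle>\<rangle> = q \<langle>i, j\<rangle>"
          using lim unfolding lim_baire_eq_Some_iff by blast
        then show ?thesis by (metis nle_le)
      qed
      then show ?thesis by simp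
    qed
    finally show ?thesis using D(2) by blast
  qed
  show ?thesis
  proof (rule sW_leI[OF K H])
    fix p A assume "in_rep (jump (BCT1 X d \<alpha>)) p = Some A" and dom: "A \<in> pdom (jump (BCT1 X d \<alpha>))"
    then obtain q where lim: "lim_baire p = Some q"
      and A: "\<And>i. A i = X - (\<Union>j. rational_ball X d \<alpha> (q \<langle>i, j\<rangle>))"
      using limit_psi_minus by (auto simp: jump_def BCT1_def)
    have "infinite {t. K p t = m} \<longleftrightarrow> even m \<and> (\<forall>j. \<not> meets p \<langle>psnd (m div 2), q \<langle>pfst (m div 2), j\<rangle>\<rangle>)" for m
      using cluster[of p m] good[OF lim, of "pfst (m div 2)" "psnd (m div 2)"] by simp
    then have cluster_iff: "infinite {t. K p t = m} \<longleftrightarrow> even m \<and>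
        mball (\<alpha> (pfst (psnd (m div 2)))) ((1/2) ^ psnd (psnd (m div 2))) \<subseteq> A (pfst (m div 2))" for m
      using meets[of p "pfst (psnd (m div 2))" "psnd (psnd (m div 2))"] mball_subset_mspace
      unfolding A by (simp, blast)
    have closed: "\<And>i. closedin mtopology (A i)" and cover: "X = (\<Union>i. A i)"
      using dom by (auto simp: jump_def BCT1_def closed_cover_seqs_def)
    have "\<exists>i. mtopology interior_of (A i) \<noteq> {}"
    proof (rule ccontr)
      assume "\<not> (\<exists>i. mtopology interior_of (A i) \<noteq> {})"
      then have "mtopology interior_of (\<Union>(range A)) = {}"
        using closed by (intro metric_Baire_category_alt complete) auto
      then show False
        using cover[symmetric] dense_in_X interior_of_topspace[of mtopology] by auto
    qed
    then obtain i n where n: "\<alpha> n \<in> mtopology interior_of (A i)"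
      using dense_openE openin_interior_of by metis
    then obtain r where r: "r > 0" "mball (\<alpha> n) r \<subseteq> mtopology interior_of (A i)"
      using openin_interior_of[of mtopology "A i", unfolded openin_mtopology] by blast
    then obtain k where "(1/2) ^ k < r" using real_arch_pow_inv[of r "1/2"] by auto
    then have "mball (\<alpha> n) ((1/2) ^ k) \<subseteq> A i"
      using r(2) interior_of_subset mball_subset_concentric by (meson less_imp_le order_trans)
    then have "infinite {t. K p t = 2 * \<langle>i, \<langle>n, k\<rangle>\<rangle>}"
      by (simp add: cluster_iff)
    then have dom_CL: "K p \<in> pdom CL_nat" by (auto simp: CL_nat_def)
    have "mtopology interior_of (A (pfst (m div 2))) \<noteq> {}" if "infinite {t. K p t = m}" for m
    proof -
      let ?ball = "mball (\<alpha> (pfst (psnd (m div 2)))) ((1/2) ^ psnd (psnd (m div 2)))"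
      have "?ball \<subseteq> mtopology interior_of (A (pfst (m div 2)))"
        using that cluster_iff by (intro interior_of_maximal) auto
      moreover have "\<alpha> (pfst (psnd (m div 2))) \<in> ?ball" using dense_in_X by simp
      ultimately show ?thesis by blast
    qed
    then have "\<exists>y'. out_rep (jump (BCT1 X d \<alpha>)) (\<lambda>n. pfst (r 0 div 2)) = Some y' \<and>
        y' \<in> vals (jump (BCT1 X d \<alpha>)) A"
      if "out_rep CL_nat r = Some y" "y \<in> vals CL_nat (K p)" for r y
      using that by (auto simp: CL_nat_def nat_rep_def jump_def BCT1_def)
    moreover have "in_rep CL_nat (K p) = Some (K p)" by (simp add: CL_nat_def)
    ultimately show "\<exists>x'. in_rep CL_nat (K p) = Some x' \<and> x' \<in> pdom CL_nat \<and>
        (\<forall>q y. out_rep CL_nat q = Some y \<longrightarrow> y \<in> vals CL_nat x' \<longrightarrow>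
          (\<exists>y'. out_rep (jump (BCT1 X d \<alpha>)) (\<lambda>n. pfst (q 0 div 2)) = Some y' \<and>
            y' \<in> vals (jump (BCT1 X d \<alpha>)) A))"
      using dom_CL by blast
  qed
qed

end

section \<open>The equivalences\<close>

theorem theorem4p3:
  fixes X :: "'a set" and d :: "'a \<Rightarrow> 'a \<Rightarrow> real" and \<alpha> :: "nat \<Rightarrow> 'a"
  assumes "computable_Polish_space X d \<alpha>" and "perfect_space X d"
  shows "jump (BCT0 X d \<alpha>) \<equiv>\<^sub>s\<^sub>W BCT2 X d \<alpha> \<and>
         jump (BCT1 X d \<alpha>) \<equiv>\<^sub>s\<^sub>W BCT3 X d \<alpha> \<and>
         BCT3 X d \<alpha> \<equiv>\<^sub>s\<^sub>W CL_nat"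
proof -
  interpret Metric_space X d
    using assms(1) by (simp add: computable_Polish_space_def computable_metric_space_def)
  interpret perfect_computable_Polish X d \<alpha>
    using assms
    by unfold_locales
      (auto simp: computable_Polish_space_def computable_metric_space_def perfect_space_def)
  have "jump (BCT1 X d \<alpha>) \<le>\<^sub>s\<^sub>W BCT3 X d \<alpha>"
    using jump_BCT1_le_CL CL_le_BCT3 by (rule sW_le_trans)
  moreover have "BCT3 X d \<alpha> \<le>\<^sub>s\<^sub>W CL_nat"
    using BCT3_le_jump_BCT1 jump_BCT1_le_CL by (rule sW_le_trans)
  ultimately show ?thesis
    unfolding sW_equiv_def
    using jump_BCT0_le_BCT2 BCT2_le_jump_BCT0 BCT3_le_jump_BCT1 CL_le_BCT3 by blast
qed

end
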